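(* Let $G$ be a block graph with diameter $3$, and let $B$ be the central block of $G$. Then $G$ is $\chi_\rho$-critical if and only if one of the following three possibilities holds for the vertices of $B$. (a) Every vertex of $B$ has degree $|V(B)|$ in $G$. (b) Every vertex of $B$ has degree $|V(B)|+1$ in $G$, and exactly $|V(B)|-1$ vertices of $B$ have two neighbors that are leaves. (c) For each vertex $x \in V(B)$ at least one of the following holds: (c1) $x$ belongs to at least one side block of order at least $4$, and $x$ has no leaf neighbor; (c2) $x$ belongs to at least two side blocks of order $3$, and $x$ has no leaf neighbor; (c3) $x$ has degree $|V(B)|+1$ in $G$ and has two neighbors that are both leaves; and in addition, at least one vertex of $B$ satisfies (c1) or (c2).
   Context: Graphs are finite and simple. A block of $G$ is a maximal connected subgraph without cut vertices; a block graph is a connected graph in which every block is a complete graph. The order of a block is its number of vertices; a leaf is a vertex of degree 1, and a leaf neighbor of $x$ is a leaf adjacent to $x$. For a block graph $G$ of diameter $3$, the radius is $2$ and the center (the set of vertices of minimum eccentricity) is exactly the vertex set of one block, called the central block $B$; all other blocks are called side blocks. A $k$-packing coloring of $G$ is a map $c:V(G)\to\{1,\ldots,k\}$ such that two distinct vertices $u,v$ with $c(u)=c(v)=i$ satisfy $d_G(u,v)>i$ (distance between vertices in different components is infinite); $\chi_\rho(G)$ is the smallest $k$ for which such a coloring exists. $G$ is $\chi_\rho$-critical if $\chi_\rho(H)<\chi_\rho(G)$ for every proper subgraph $H$ of $G$. *)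

theory Defs
  imports Main "HOL-Library.Extended_Nat"
begin

definition graph :: "'a set \<Rightarrow> 'a set set \<Rightarrow> bool" where
  "graph V E \<longleftrightarrow> finite V \<and>
     (\<forall>e\<in>E. \<exists>u v. e = {u, v} \<and> u \<noteq> v \<and> u \<in> V \<and> v \<in> V)"

definition walk :: "'a set set \<Rightarrow> 'a list \<Rightarrow> bool" where
  "walk E xs \<longleftrightarrow> xs \<noteq> [] \<and> (\<forall>i. Suc i < length xs \<longrightarrow> {xs ! i, xs ! Suc i} \<in> E)"

text \<open>Distance; infinite (\<infinity>) if there is no walk.\<close>
definition dist :: "'a set set \<Rightarrow> 'a \<Rightarrow> 'a \<Rightarrow> enat" where
  "dist E u v = Inf {enat (length xs - 1) | xs. walk E xs \<and> hd xs = u \<and> last xs = v}"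

definition connected :: "'a set \<Rightarrow> 'a set set \<Rightarrow> bool" where
  "connected V E \<longleftrightarrow> V \<noteq> {} \<and> (\<forall>u\<in>V. \<forall>v\<in>V. dist E u v < \<infinity>)"

definition induced :: "'a set set \<Rightarrow> 'a set \<Rightarrow> 'a set set" where
  "induced E S = {e \<in> E. e \<subseteq> S}"

definition nonsep :: "'a set set \<Rightarrow> 'a set \<Rightarrow> bool" where
  "nonsep E S \<longleftrightarrow> connected S (induced E S) \<and>
     (\<forall>x\<in>S. S - {x} \<noteq> {} \<longrightarrow> connected (S - {x}) (induced E (S - {x})))"

text \<open>Vertex sets of blocks: maximal connected subgraphs without cut vertices
  (blocks are always induced subgraphs).\<close>
definition block :: "'a set \<Rightarrow> 'a set set \<Rightarrow> 'a set \<Rightarrow> bool" where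
  "block V E S \<longleftrightarrow> S \<subseteq> V \<and> nonsep E S \<and> (\<forall>T. S \<subset> T \<and> T \<subseteq> V \<longrightarrow> \<not> nonsep E T)"

definition block_graph :: "'a set \<Rightarrow> 'a set set \<Rightarrow> bool" where
  "block_graph V E \<longleftrightarrow> connected V E \<and>
     (\<forall>S. block V E S \<longrightarrow> (\<forall>u\<in>S. \<forall>v\<in>S. u \<noteq> v \<longrightarrow> {u, v} \<in> E))"

definition diameter :: "'a set \<Rightarrow> 'a set set \<Rightarrow> enat" where
  "diameter V E = Sup {dist E u v | u v. u \<in> V \<and> v \<in> V}"

definition ecc :: "'a set \<Rightarrow> 'a set set \<Rightarrow> 'a \<Rightarrow> enat" where
  "ecc V E v = Sup {dist E v u | u. u \<in> V}"

definition center :: "'a set \<Rightarrow> 'a set set \<Rightarrow> 'a set" where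
  "center V E = {v \<in> V. \<forall>w\<in>V. ecc V E v \<le> ecc V E w}"

definition central_block :: "'a set \<Rightarrow> 'a set set \<Rightarrow> 'a set \<Rightarrow> bool" where
  "central_block V E B \<longleftrightarrow> block V E B \<and> B = center V E"

definition side_block :: "'a set \<Rightarrow> 'a set set \<Rightarrow> 'a set \<Rightarrow> 'a set \<Rightarrow> bool" where
  "side_block V E B S \<longleftrightarrow> block V E S \<and> S \<noteq> B"

definition nbrs :: "'a set set \<Rightarrow> 'a \<Rightarrow> 'a set" where
  "nbrs E x = {u. {x, u} \<in> E}"

definition degree :: "'a set set \<Rightarrow> 'a \<Rightarrow> nat" where
  "degree E x = card (nbrs E x)"

definition leaf_nbrs :: "'a set set \<Rightarrow> 'a \<Rightarrow> 'a set" where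
  "leaf_nbrs E x = {u \<in> nbrs E x. degree E u = 1}"

definition packing_coloring :: "'a set \<Rightarrow> 'a set set \<Rightarrow> nat \<Rightarrow> ('a \<Rightarrow> nat) \<Rightarrow> bool" where
  "packing_coloring V E k c \<longleftrightarrow>
     (\<forall>v\<in>V. 1 \<le> c v \<and> c v \<le> k) \<and>
     (\<forall>u\<in>V. \<forall>v\<in>V. u \<noteq> v \<and> c u = c v \<longrightarrow> dist E u v > enat (c u))"

definition packing_chromatic :: "'a set \<Rightarrow> 'a set set \<Rightarrow> nat" where
  "packing_chromatic V E = (LEAST k. \<exists>c. packing_coloring V E k c)"

definition proper_subgraph :: "'a set \<Rightarrow> 'a set set \<Rightarrow> 'a set \<Rightarrow> 'a set set \<Rightarrow> bool" where
  "proper_subgraph V' E' V E \<longleftrightarrow> graph V' E' \<and> V' \<subseteq> V \<and> E' \<subseteq> E \<and> (V', E') \<noteq> (V, E)"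

definition packing_critical :: "'a set \<Rightarrow> 'a set set \<Rightarrow> bool" where
  "packing_critical V E \<longleftrightarrow>
     (\<forall>V' E'. proper_subgraph V' E' V E \<longrightarrow> packing_chromatic V' E' < packing_chromatic V E)"

end

theory Submission
  imports Defs
begin

text \<open>
  The colours 3, 4, ... occur at most once in a graph of diameter 3, so the packing
  chromatic number is \<open>|V| + 2 - M\<close>, where M is the maximal size of a union of disjoint sets I, J
  with I independent (colour 1) and the vertices of J pairwise at distance at least 3 (colour 2).
  The graph is the clique B with disjoint cliques attached to its vertices.  If R contains one vertex
  of each attached clique and T is the set of vertices of B carrying an attached clique with at least
  two vertices, then a best choice is either I = R together with one further vertex of J at every
  element of T, or I = R together with \<open>|J| = 1\<close> and J inside B; in both cases one more vertex is
  gained if some vertex of B has at most one neighbour outside B (respectively none).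
  Comparing these values before and after deleting a leaf, the outer edge of a pendant triangle, or
  an edge of B at a vertex without neighbours outside B excludes everything but (a), (b), (c).
  Conversely, in these cases every edge deletion allows M to grow by one, except that the deletion
  of an edge \<open>ab\<close> of B may instead create two vertices at distance 4 that share colour 3.
\<close>

section \<open>Distances and packing colourings\<close>

text \<open>Explicit colourings bound the chromatic number from above after any deletion; a matching
  lower bound needs all distances to stay at most 3. So necessity is tested on deletions after which
  the graph is again a clique with attached cliques, where the same pair of bounds applies. Deleting
  an edge of B at a bare vertex is the one exception and gets its own count. Sufficiency needs only
  colourings and, by monotonicity, only for the deletion of a single edge. The numbers in the three
  cases come from bookkeeping. A leaf outside B counts once in \<open>V\<close> and once in
  \<open>R\<close>, so removing it saves a colour only if one of the two bonus terms switches on;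
  this fixes the number of outer neighbours at its root. Cutting a pendant triangle moves one unit
  from \<open>T\<close> to \<open>R\<close>, which pays only if \<open>T\<close> was a single
  vertex; hence the single exceptional vertex of (b). Three outer neighbours, as in (c1) and (c2),
  always leave a vertex free for colour 2 or 3 beside a recoloured clique.\<close>

definition arcs :: "'a set set \<Rightarrow> ('a \<times> 'a) set" where
  "arcs E = {(u, v). {u, v} \<in> E}"

text \<open>With stationary steps allowed, distance at most k is a chain of exactly k
  \<open>near\<close> steps, so the bounds 1, 2 and 3 need no split over shorter walks.\<close>

definition near :: "'a set set \<Rightarrow> 'a \<Rightarrow> 'a \<Rightarrow> bool" where
  "near E u v \<longleftrightarrow> u = v \<or> {u, v} \<in> E"

lemma arcs_iff [simp]: "(u, v) \<in> arcs E \<longleftrightarrow> {u, v} \<in> E"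
  by (simp add: arcs_def)

lemma sym_arcs: "sym (arcs E)"
  by (auto simp: sym_def insert_commute)

lemma near_refl [simp]: "near E u u"
  by (simp add: near_def)

lemma near_sym: "near E u v \<Longrightarrow> near E v u"
  by (auto simp: near_def insert_commute)

lemma near_mono: "near E' u v \<Longrightarrow> E' \<subseteq> E \<Longrightarrow> near E u v"
  by (auto simp: near_def)

text \<open>The bridge from list walks to powers of a relation: the infimum over walk lengths
  becomes a statement about exponents of \<open>arcs E\<close>.\<close>

lemma walk_iff_relpow:
  "(\<exists>xs. walk E xs \<and> hd xs = u \<and> last xs = v \<and> length xs - 1 = n) \<longleftrightarrow> (u, v) \<in> arcs E ^^ n"
proof
  assume "\<exists>xs. walk E xs \<and> hd xs = u \<and> last xs = v \<and> length xs - 1 = n"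
  then obtain xs where xs: "walk E xs" "hd xs = u" "last xs = v" "length xs - 1 = n" by blast
  then show "(u, v) \<in> arcs E ^^ n"
    unfolding relpow_fun_conv walk_def
    by (intro exI[of _ "nth xs"]) (auto simp: hd_conv_nth last_conv_nth)
next
  assume "(u, v) \<in> arcs E ^^ n"
  then obtain f where f: "f 0 = u" "f n = v" "\<forall>i<n. {f i, f (Suc i)} \<in> E"
    unfolding relpow_fun_conv by auto
  then show "\<exists>xs. walk E xs \<and> hd xs = u \<and> last xs = v \<and> length xs - 1 = n"
    unfolding walk_def
    by (intro exI[of _ "map f [0..<Suc n]"])
      (auto simp: hd_conv_nth last_conv_nth nth_append less_Suc_eq simp del: upt_Suc,
        simp add: nth_append)
qed

lemma dist_less_iff: "dist E u v < a \<longleftrightarrow> (\<exists>n. enat n < a \<and> (u, v) \<in> arcs E ^^ n)"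
  unfolding dist_def Inf_less_iff walk_iff_relpow[symmetric] by auto

lemma dist_le_iff: "dist E u v \<le> enat k \<longleftrightarrow> (\<exists>n\<le>k. (u, v) \<in> arcs E ^^ n)"
proof -
  have "dist E u v \<le> enat k \<longleftrightarrow> dist E u v < enat (Suc k)"
    by (cases "dist E u v") auto
  then show ?thesis by (simp add: dist_less_iff less_Suc_eq_le)
qed

lemma dist_finite_iff: "dist E u v < \<infinity> \<longleftrightarrow> (u, v) \<in> (arcs E)\<^sup>*"
  unfolding dist_less_iff rtrancl_power by simp

lemma dist_le_0: "dist E u v \<le> enat 0 \<longleftrightarrow> u = v"
  by (auto simp: dist_le_iff)

lemma dist_le_Suc:
  "dist E u v \<le> enat (Suc k) \<longleftrightarrow> (\<exists>w. near E u w \<and> dist E w v \<le> enat k)"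
proof
  assume "dist E u v \<le> enat (Suc k)"
  then obtain n where n: "n \<le> Suc k" "(u, v) \<in> arcs E ^^ n" by (auto simp: dist_le_iff)
  show "\<exists>w. near E u w \<and> dist E w v \<le> enat k"
  proof (cases n)
    case 0
    then show ?thesis using n by (intro exI[of _ u]) (auto simp: dist_le_iff intro: exI[of _ 0])
  next
    case (Suc m)
    with n(2) obtain w where "(u, w) \<in> arcs E" "(w, v) \<in> arcs E ^^ m"
      by (metis relpow_Suc_D2)
    then show ?thesis using n Suc by (intro exI[of _ w]) (auto simp: dist_le_iff near_def)
  qed
next
  assume "\<exists>w. near E u w \<and> dist E w v \<le> enat k"
  then obtain w n where w: "near E u w" "n \<le> k" "(w, v) \<in> arcs E ^^ n" by (auto simp: dist_le_iff)
  show "dist E u v \<le> enat (Suc k)"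
  proof (cases "u = w")
    case True
    then show ?thesis using w by (auto simp: dist_le_iff intro: exI[of _ n])
  next
    case False
    then have "(u, w) \<in> arcs E" using w by (auto simp: near_def)
    then have "(u, v) \<in> arcs E ^^ Suc n" using w(3) by (rule relpow_Suc_I2)
    then show ?thesis using w(2) unfolding dist_le_iff by (metis Suc_le_mono)
  qed
qed

lemma dist_le_1: "dist E u v \<le> enat 1 \<longleftrightarrow> near E u v"
  by (simp add: dist_le_Suc dist_le_0)

lemma dist_le_2: "dist E u v \<le> enat 2 \<longleftrightarrow> (\<exists>w. near E u w \<and> near E w v)"
  by (simp add: numeral_2_eq_2 dist_le_Suc dist_le_0)

lemma dist_le_3:
  "dist E u v \<le> enat 3 \<longleftrightarrow> (\<exists>w z. near E u w \<and> near E w z \<and> near E z v)"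
  by (simp add: numeral_3_eq_3 dist_le_Suc dist_le_0)

lemma relpow_mono_arcs: "E' \<subseteq> E \<Longrightarrow> arcs E' ^^ n \<subseteq> arcs E ^^ n"
  by (induction n) (auto simp: arcs_def intro!: relcomp_mono)

lemma dist_antimono: "E' \<subseteq> E \<Longrightarrow> dist E u v \<le> dist E' u v"
  unfolding not_less[symmetric] dist_less_iff using relpow_mono_arcs
  by (metis dist_less_iff order_less_irrefl subsetD)

section \<open>Sets admissible as one colour class, and bounds on the packing chromatic
  number\<close>

definition spread :: "'a set set \<Rightarrow> nat \<Rightarrow> 'a set \<Rightarrow> bool" where
  "spread E d X \<longleftrightarrow> (\<forall>u\<in>X. \<forall>v\<in>X. u \<noteq> v \<longrightarrow> dist E u v > enat d)"

lemma spread_1_iff: "spread E 1 X \<longleftrightarrow> (\<forall>u\<in>X. \<forall>v\<in>X. u \<noteq> v \<longrightarrow> {u, v} \<notin> E)"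
  unfolding spread_def not_le[symmetric] dist_le_1 near_def by blast

lemma spread_2_iff:
  "spread E 2 X \<longleftrightarrow> (\<forall>u\<in>X. \<forall>v\<in>X. u \<noteq> v \<longrightarrow> \<not> (\<exists>w. near E u w \<and> near E w v))"
  unfolding spread_def not_le[symmetric] dist_le_2 by blast

text \<open>Vertices outside \<open>W\<close> receive pairwise different colours above
  \<open>m\<close>, which cannot clash with anything; each of them costs one colour.\<close>

lemma coloring_extend:
  assumes "finite V" "W \<subseteq> V" "\<And>v. v \<in> W \<Longrightarrow> 1 \<le> c v \<and> c v \<le> m"
    and "\<And>u v. u \<in> W \<Longrightarrow> v \<in> W \<Longrightarrow> u \<noteq> v \<Longrightarrow> c u = c v \<Longrightarrow> dist E u v > enat (c u)"
  shows "\<exists>c. packing_coloring V E (m + card (V - W)) c"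
proof -
  have "finite (V - W)" using assms(1) by blast
  then obtain f where f: "bij_betw f (V - W) {0..<card (V - W)}"
    using ex_bij_betw_finite_nat by blast
  have f1: "f v < card (V - W)" if "v \<in> V" "v \<notin> W" for v
    using f that by (auto simp: bij_betw_def)
  have f2: "u = v" if "u \<in> V" "v \<in> V" "u \<notin> W" "v \<notin> W" "f u = f v" for u v
    using f that by (auto simp: bij_betw_def inj_on_def)
  define d where "d v = (if v \<in> W then c v else Suc (m + f v))" for v
  have 1: "\<forall>v\<in>V. 1 \<le> d v \<and> d v \<le> m + card (V - W)"
    using assms(3) f1 by (auto simp: d_def Suc_le_eq trans_le_add1)
  have 2: "dist E u v > enat (d u)" if "u \<in> V" "v \<in> V" "u \<noteq> v" "d u = d v" for u v
  proof -
    have "u \<in> W \<and> v \<in> W"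
    proof (rule ccontr)
      assume "\<not> (u \<in> W \<and> v \<in> W)"
      then show False using that f2[of u v] assms(3)[of u] assms(3)[of v]
        by (auto simp: d_def split: if_splits)
    qed
    then show ?thesis using that assms(4) by (auto simp: d_def)
  qed
  show ?thesis using 1 2 unfolding packing_coloring_def by blast
qed

lemma chromatic_le: "packing_coloring V E k c \<Longrightarrow> packing_chromatic V E \<le> k"
  unfolding packing_chromatic_def by (rule Least_le) blast

lemma chromatic_attained:
  assumes "finite V"
  shows "\<exists>c. packing_coloring V E (packing_chromatic V E) c"
proof -
  have "\<exists>k c. packing_coloring V E k c"
    using coloring_extend[OF assms, of "{}" undefined 0 E] by blast
  then show ?thesis unfolding packing_chromatic_def by (rule LeastI_ex)
qed

lemma chromatic_mono:
  assumes "finite V" "V' \<subseteq> V" "E' \<subseteq> E"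
  shows "packing_chromatic V' E' \<le> packing_chromatic V E"
proof -
  obtain c where "packing_coloring V E (packing_chromatic V E) c"
    using chromatic_attained[OF assms(1)] by blast
  then have "packing_coloring V' E' (packing_chromatic V E) c"
    using assms(2) dist_antimono[OF assms(3)] unfolding packing_coloring_def
    by (meson less_le_trans subsetD)
  then show ?thesis by (rule chromatic_le)
qed

lemma chromatic_le_two_classes:
  assumes "finite V" "I \<subseteq> V" "J \<subseteq> V" "I \<inter> J = {}" "spread E 1 I" "spread E 2 J"
  shows "packing_chromatic V E + card (I \<union> J) \<le> card V + 2"
proof -
  define c :: "'a \<Rightarrow> nat" where "c v = (if v \<in> I then 1 else 2)" for v
  have "\<exists>c. packing_coloring V E (2 + card (V - (I \<union> J))) c"
  proof (rule coloring_extend[of V "I \<union> J" c])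
    fix u v assume "u \<in> I \<union> J" "v \<in> I \<union> J" "u \<noteq> v" "c u = c v"
    then show "dist E u v > enat (c u)" using assms(5,6) unfolding c_def spread_def
      by (metis UnE numeral_eq_one_iff semiring_norm(85))
  qed (use assms(1-3) in \<open>auto simp: c_def\<close>)
  then have "packing_chromatic V E \<le> 2 + card (V - (I \<union> J))"
    using chromatic_le by blast
  moreover have "card (V - (I \<union> J)) = card V - card (I \<union> J)" "card (I \<union> J) \<le> card V"
    using assms by (auto intro!: card_Diff_subset card_mono finite_subset[of _ V])
  ultimately show ?thesis by linarith
qed

text \<open>One better than with two classes: \<open>p\<close> and \<open>q\<close> share colour 3
  instead of using two private colours.\<close>

lemma chromatic_le_three_classes:
  assumes "finite V" "I \<subseteq> V" "J \<subseteq> V" "I \<inter> J = {}" "spread E 1 I" "spread E 2 J"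
    and "p \<in> V - I - J" "q \<in> V - I - J" "p \<noteq> q" "dist E p q > enat 3" "dist E q p > enat 3"
  shows "packing_chromatic V E + card (I \<union> J) \<le> card V + 1"
proof -
  define c :: "'a \<Rightarrow> nat" where "c v = (if v \<in> I then 1 else if v \<in> J then 2 else 3)" for v
  let ?W = "I \<union> J \<union> {p, q}"
  have "\<exists>c. packing_coloring V E (3 + card (V - ?W)) c"
  proof (rule coloring_extend[of V ?W c])
    fix u v assume *: "u \<in> ?W" "v \<in> ?W" "u \<noteq> v" "c u = c v"
    then consider "u \<in> I" "v \<in> I" | "u \<in> J" "v \<in> J" "u \<notin> I"
      | "u \<in> {p, q}" "v \<in> {p, q}" "u \<notin> I" "u \<notin> J"
      using assms(7,8) by (auto simp: c_def split: if_splits)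
    then show "dist E u v > enat (c u)"
    proof cases
      case 1
      then show ?thesis using assms(5) * by (simp add: c_def spread_def)
    next
      case 2
      then show ?thesis using assms(6) * by (simp add: c_def spread_def)
    next
      case 3
      then show ?thesis using assms(10,11) * by (auto simp: c_def)
    qed
  qed (use assms(1-3,7,8) in \<open>auto simp: c_def\<close>)
  then have "packing_chromatic V E \<le> 3 + card (V - ?W)"
    using chromatic_le by blast
  moreover have "?W \<subseteq> V" "finite ?W" using assms by (auto intro: finite_subset[of _ V])
  then have "card (V - ?W) = card V - card ?W" "card ?W \<le> card V"
    using assms(1) by (simp_all only: card_Diff_subset card_mono)
  moreover have "card ?W = card (I \<union> J) + 2"
    by (subst card_Un_disjoint) (use assms in \<open>auto intro: finite_subset[of _ V]\<close>)
  ultimately show ?thesis by linarith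
qed

text \<open>I and J are the first two classes of an optimal colouring with k colours; by the
  distance bound all remaining vertices inject into \<open>{3..k}\<close>.\<close>

lemma chromatic_ge_two_classes:
  assumes "finite V" and d3: "\<And>u v. u \<in> V \<Longrightarrow> v \<in> V \<Longrightarrow> dist E u v \<le> enat 3"
    and ab: "a \<in> V" "b \<in> V" "a \<noteq> b" "{a, b} \<in> E"
  obtains I J where "I \<subseteq> V" "J \<subseteq> V" "I \<inter> J = {}" "spread E 1 I" "spread E 2 J"
    "card V + 2 \<le> packing_chromatic V E + card (I \<union> J)"
proof -
  let ?k = "packing_chromatic V E"
  obtain c where c: "packing_coloring V E ?k c"
    using chromatic_attained[OF assms(1)] by blast
  define I J where "I = {v \<in> V. c v = 1}" and "J = {v \<in> V. c v = 2}"
  have far: "dist E u v > enat (c u)" if "u \<in> V" "v \<in> V" "u \<noteq> v" "c u = c v" for u v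
    using c that unfolding packing_coloring_def by blast
  have rng: "1 \<le> c v" "c v \<le> ?k" if "v \<in> V" for v
    using c that unfolding packing_coloring_def by blast+
  \<comment> \<open>The edge forces a second colour; with k = 1 the difference \<open>?k - 2\<close>
    would be truncated and the final count off by one.\<close>
  have k2: "2 \<le> ?k"
  proof (rule ccontr)
    assume "\<not> 2 \<le> ?k"
    then have "c a = 1" "c b = 1" using rng[of a] rng[of b] ab by auto
    then show False using far[of a b] ab dist_le_1[of E a b]
      by (auto simp: near_def not_le[symmetric])
  qed
  let ?K = "V - (I \<union> J)"
  have ge3: "3 \<le> c v" if "v \<in> ?K" for v
    using that rng[of v] by (auto simp: I_def J_def)
  have "inj_on c ?K"
  proof (rule inj_onI, rule ccontr)
    fix u v assume uv: "u \<in> ?K" "v \<in> ?K" "c u = c v" "u \<noteq> v"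
    then have "dist E u v > enat (c u)" using far by blast
    moreover have "enat 3 \<le> enat (c u)" using ge3 uv by simp
    ultimately show False using d3[of u v] uv by (meson DiffD1 leD le_less_trans)
  qed
  moreover have "c ` ?K \<subseteq> {3..?k}" using ge3 rng by (meson DiffD1 atLeastAtMost_iff image_subsetI)
  ultimately have "card ?K \<le> card {3..?k}" by (intro card_inj_on_le[of c]) auto
  then have "card ?K \<le> ?k - 2" by simp
  moreover have "card ?K = card V - card (I \<union> J)" "card (I \<union> J) \<le> card V"
    using assms(1) by (auto simp: I_def J_def intro!: card_Diff_subset card_mono)
  ultimately have "card V + 2 \<le> ?k + card (I \<union> J)" using k2 by linarith
  moreover have "spread E 1 I" "spread E 2 J"
    using far by (auto simp: spread_def I_def J_def) metis+
  moreover have "I \<subseteq> V" "J \<subseteq> V" "I \<inter> J = {}" by (auto simp: I_def J_def)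
  ultimately show ?thesis using that[of I J] by blast
qed

text \<open>A proper subgraph with all edges would lack a vertex, but every vertex lies on an edge.
  So some edge e is missing, the subgraph lies inside \<open>(V, E - {e})\<close>, and monotonicity
  applies.\<close>

lemma critical_iff_edges:
  assumes "graph V E" and cov: "\<And>v. v \<in> V \<Longrightarrow> \<exists>e\<in>E. v \<in> e"
  shows "packing_critical V E \<longleftrightarrow>
    (\<forall>e\<in>E. packing_chromatic V (E - {e}) < packing_chromatic V E)"
proof
  assume "packing_critical V E"
  moreover have "proper_subgraph V (E - {e}) V E" if "e \<in> E" for e
    using assms(1) that by (auto simp: proper_subgraph_def graph_def)
  ultimately show "\<forall>e\<in>E. packing_chromatic V (E - {e}) < packing_chromatic V E"
    by (simp add: packing_critical_def)
next
  assume less: "\<forall>e\<in>E. packing_chromatic V (E - {e}) < packing_chromatic V E"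
  show "packing_critical V E"
    unfolding packing_critical_def
  proof (intro allI impI)
    fix V' E' assume sub: "proper_subgraph V' E' V E"
    have "E' \<noteq> E"
    proof
      assume "E' = E"
      with sub obtain v where v: "v \<in> V" "v \<notin> V'" by (auto simp: proper_subgraph_def)
      with cov obtain e where "e \<in> E" "v \<in> e" by blast
      then show False using sub v \<open>E' = E\<close> by (fastforce simp: proper_subgraph_def graph_def)
    qed
    then obtain e where e: "e \<in> E" "E' \<subseteq> E - {e}"
      using sub by (auto simp: proper_subgraph_def)
    have "packing_chromatic V' E' \<le> packing_chromatic V (E - {e})"
      using sub assms(1) e by (intro chromatic_mono) (auto simp: proper_subgraph_def graph_def)
    then show "packing_chromatic V' E' < packing_chromatic V E" using less e by fastforce
  qed
qed

section \<open>Cycles in block graphs\<close>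

definition clique :: "'a set set \<Rightarrow> 'a set \<Rightarrow> bool" where
  "clique E S \<longleftrightarrow> (\<forall>u\<in>S. \<forall>v\<in>S. u \<noteq> v \<longrightarrow> {u, v} \<in> E)"

abbreviation linked :: "'a set set \<Rightarrow> 'a set \<Rightarrow> ('a \<times> 'a) set" where
  "linked E S \<equiv> (arcs (induced E S))\<^sup>*"

lemma linked_step: "{u, v} \<in> E \<Longrightarrow> u \<in> S \<Longrightarrow> v \<in> S \<Longrightarrow> (u, v) \<in> linked E S"
  by (rule r_into_rtrancl) (simp add: induced_def)

lemma linked_sym: "(u, v) \<in> linked E S \<Longrightarrow> (v, u) \<in> linked E S"
  using sym_rtrancl[OF sym_arcs] by (rule symD)

lemma connected_iff: "connected S (induced E S) \<longleftrightarrow> S \<noteq> {} \<and> (\<forall>u\<in>S. \<forall>v\<in>S. (u, v) \<in> linked E S)"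
  unfolding connected_def dist_finite_iff ..

lemma connected_from_root:
  assumes "r \<in> S" "\<And>v. v \<in> S \<Longrightarrow> (r, v) \<in> linked E S"
  shows "connected S (induced E S)"
  unfolding connected_iff using assms linked_sym rtrancl_trans by (metis empty_iff)

lemma clique_connected: "clique E S \<Longrightarrow> S \<noteq> {} \<Longrightarrow> connected S (induced E S)"
  unfolding connected_iff clique_def using linked_step by (metis rtrancl.rtrancl_refl)

lemma clique_nonsep: "clique E S \<Longrightarrow> S \<noteq> {} \<Longrightarrow> nonsep E S"
  unfolding nonsep_def using clique_connected by (metis Diff_iff clique_def)

lemma linked_path:
  assumes "successively (\<lambda>u v. {u, v} \<in> E) xs" "set xs \<subseteq> S" "xs \<noteq> []" "v \<in> set xs"
  shows "(hd xs, v) \<in> linked E S"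
  using assms
proof (induction xs rule: induct_list012)
  case (3 x y zs)
  have "(x, y) \<in> linked E S" using 3 by (intro linked_step) auto
  moreover have "(y, v) \<in> linked E S" if "v \<in> set (y # zs)" using 3 that by auto
  ultimately show ?case using 3 by (auto intro: rtrancl_trans)
qed auto

lemma linked_path_last:
  assumes "successively (\<lambda>u v. {u, v} \<in> E) xs" "set xs \<subseteq> S" "xs \<noteq> []" "v \<in> set xs"
  shows "(last xs, v) \<in> linked E S"
  using linked_path[of E "rev xs" S v] assms
  by (simp add: hd_rev insert_commute)

text \<open>The cycle is opened at \<open>m\<close>, and \<open>xs\<close> is the remaining path.
  Removing \<open>m\<close> leaves the path; removing another vertex leaves two pieces of the path,
  each hanging on \<open>m\<close> by its outer end.\<close>

lemma cycle_nonsep: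
  assumes "successively (\<lambda>u v. {u, v} \<in> E) xs" "distinct xs" "xs \<noteq> []" "m \<notin> set xs"
    and "{m, hd xs} \<in> E" "{m, last xs} \<in> E"
  shows "nonsep E (insert m (set xs))"
proof -
  have conn: "connected (insert m (set xs)) (induced E (insert m (set xs)))"
  proof (rule connected_from_root)
    fix v assume v: "v \<in> insert m (set xs)"
    have "(m, hd xs) \<in> linked E (insert m (set xs))" using assms by (intro linked_step) auto
    moreover have "(hd xs, v) \<in> linked E (insert m (set xs))" if "v \<in> set xs"
      using assms that by (intro linked_path) auto
    ultimately show "(m, v) \<in> linked E (insert m (set xs))"
      using v by (auto intro: rtrancl_trans)
  qed simp
  have "connected (insert m (set xs) - {z}) (induced E (insert m (set xs) - {z}))"
    if z: "z \<in> insert m (set xs)" for z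
  proof (cases "z = m")
    case True
    then have "insert m (set xs) - {z} = set xs" using assms by auto
    moreover have "connected (set xs) (induced E (set xs))"
      using connected_from_root[of "hd xs" "set xs" E] linked_path[OF assms(1) subset_refl] assms(3)
      by simp
    ultimately show ?thesis by simp
  next
    case False
    then obtain ys zs where xs: "xs = ys @ z # zs" using z by (metis insertE split_list)
    let ?S = "insert m (set xs) - {z}"
    have S: "?S = insert m (set ys \<union> set zs)" using xs assms(2,4) by auto
    show ?thesis
    proof (rule connected_from_root[of m])
      fix v assume "v \<in> ?S"
      then consider "v = m" | "v \<in> set ys" | "v \<in> set zs" using S by auto
      then show "(m, v) \<in> linked E ?S"
      proof cases
        case 2
        then have ne: "ys \<noteq> []" by auto
        have "{m, hd ys} \<in> E" using assms(5) ne by (simp add: xs)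
        then have "(m, hd ys) \<in> linked E ?S"
          unfolding S by (rule linked_step) (use ne in auto)
        moreover have "(hd ys, v) \<in> linked E ?S"
          unfolding S using assms(1) 2 ne
          by (intro linked_path) (auto simp: xs successively_append_iff)
        ultimately show ?thesis by (rule rtrancl_trans)
      next
        case 3
        then have ne: "zs \<noteq> []" by auto
        have "{m, last zs} \<in> E" using assms(6) ne by (simp add: xs)
        then have "(m, last zs) \<in> linked E ?S"
          unfolding S by (rule linked_step) (use ne in auto)
        moreover have "(last zs, v) \<in> linked E ?S"
          unfolding S using assms(1) 3 ne
          by (intro linked_path_last) (auto simp: xs successively_append_iff successively_Cons)
        ultimately show ?thesis by (rule rtrancl_trans)
      qed auto
    qed (use False in auto)
  qed
  then show ?thesis unfolding nonsep_def using conn by blast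
qed

text \<open>The path is kept simple while it grows: if the next vertex is already on it, the path is
  cut back to that vertex.\<close>

lemma linked_avoiding_path:
  assumes "(a, b) \<in> {(u, v). {u, v} \<in> E \<and> u \<noteq> m \<and> v \<noteq> m}\<^sup>*" "a \<noteq> m"
  shows "\<exists>xs. xs \<noteq> [] \<and> hd xs = a \<and> last xs = b \<and> distinct xs \<and> m \<notin> set xs \<and>
    successively (\<lambda>u v. {u, v} \<in> E) xs"
  using assms
proof (induction rule: rtrancl_induct)
  case base
  then show ?case by (intro exI[of _ "[a]"]) auto
next
  case (step b c)
  then obtain xs where xs: "xs \<noteq> []" "hd xs = a" "last xs = b" "distinct xs" "m \<notin> set xs"
    "successively (\<lambda>u v. {u, v} \<in> E) xs" by auto
  show ?case
  proof (cases "c \<in> set xs")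
    case True
    then obtain ys zs where "xs = ys @ c # zs" by (metis split_list)
    then show ?thesis using xs
      by (intro exI[of _ "ys @ [c]"]) (auto simp: successively_append_iff hd_append split: if_splits)
  next
    case False
    then show ?thesis using xs step
      by (intro exI[of _ "xs @ [c]"]) (auto simp: successively_append_iff)
  qed
qed

section \<open>Edges forced by cycles in a block graph\<close>

locale blockgraph =
  fixes V :: "'a set" and E :: "'a set set"
  assumes gr: "graph V E" and bg: "block_graph V E"
begin

lemma edge_in_V: "{u, v} \<in> E \<Longrightarrow> u \<in> V \<and> v \<in> V \<and> u \<noteq> v"
  using gr unfolding graph_def by (metis doubleton_eq_iff)

lemma nonsep_clique:
  assumes "nonsep E S" "S \<subseteq> V"
  shows "clique E S"
proof -
  have fin: "finite {T. T \<subseteq> V \<and> nonsep E T}" using gr by (auto simp: graph_def)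
  obtain T where T: "T \<subseteq> V" "nonsep E T" "S \<subseteq> T"
    "\<forall>T'. T' \<subseteq> V \<and> nonsep E T' \<longrightarrow> T \<subseteq> T' \<longrightarrow> T = T'"
    using finite_has_maximal2[OF fin, of S] assms by auto
  then have "block V E T" unfolding block_def by (metis psubset_eq)
  then show ?thesis using bg T(3) unfolding block_graph_def clique_def by blast
qed

text \<open>From here on blocks are maximal cliques, and connectivity no longer has to be mentioned.
  By finiteness every non-separable set lies in a block, hence is a clique.\<close>

lemma block_iff: "block V E S \<longleftrightarrow> S \<subseteq> V \<and> S \<noteq> {} \<and> clique E S \<and>
    (\<forall>T. S \<subset> T \<and> T \<subseteq> V \<longrightarrow> \<not> clique E T)"
  unfolding block_def using nonsep_clique clique_nonsep
  by (metis connected_def nonsep_def psubset_imp_subset subset_empty)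

text \<open>A simple path avoiding \<open>m\<close> closes to a cycle through \<open>m\<close>;
  cycles are non-separable, so their vertices are pairwise adjacent.\<close>

lemma adjacent_if_linked_avoiding:
  assumes "(a, b) \<in> {(u, v). {u, v} \<in> E \<and> u \<noteq> m \<and> v \<noteq> m}\<^sup>*"
    and "{m, a} \<in> E" "{m, b} \<in> E" "a \<noteq> b"
  shows "{a, b} \<in> E"
proof -
  have "a \<noteq> m" using edge_in_V assms by blast
  then obtain xs where xs: "xs \<noteq> []" "hd xs = a" "last xs = b" "distinct xs" "m \<notin> set xs"
    "successively (\<lambda>u v. {u, v} \<in> E) xs"
    using linked_avoiding_path[OF assms(1)] by auto
  have "x \<in> V" if "x \<in> set xs" for x
    using xs(6) that assms(2) xs(1,2)
  proof (induction xs rule: rev_induct)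
    case (snoc y ys)
    show ?case
    proof (cases "x = y")
      case True
      then show ?thesis using snoc edge_in_V
        by (cases "ys = []") (auto simp: successively_append_iff)
    next
      case False
      then show ?thesis using snoc by (cases "ys = []") (auto simp: successively_append_iff)
    qed
  qed auto
  then have "insert m (set xs) \<subseteq> V" using assms edge_in_V by auto
  moreover have "nonsep E (insert m (set xs))"
    using xs assms by (intro cycle_nonsep) auto
  ultimately have "clique E (insert m (set xs))" by (rule nonsep_clique[rotated])
  moreover have "a \<in> set xs" "b \<in> set xs" using xs by auto
  ultimately show ?thesis using assms(4) by (auto simp: clique_def)
qed

text \<open>The 4-cycle m, a, c, b has the chord \<open>ab\<close>. This is the form in which the
  block condition enters the analysis of B.\<close>

lemma diamond:
  assumes "{m, a} \<in> E" "{m, b} \<in> E" "{c, a} \<in> E" "{c, b} \<in> E" "a \<noteq> b" "m \<noteq> c"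
  shows "{a, b} \<in> E"
proof (rule adjacent_if_linked_avoiding[of a b m])
  let ?r = "{(u, v). {u, v} \<in> E \<and> u \<noteq> m \<and> v \<noteq> m}"
  have "(a, c) \<in> ?r" "(c, b) \<in> ?r" using assms edge_in_V by (auto simp: insert_commute)
  then show "(a, b) \<in> ?r\<^sup>*" by (meson r_into_rtrancl rtrancl_trans)
qed (use assms in auto)

lemma near_chain_linked:
  assumes "near E a b" "a \<noteq> m" "b \<noteq> m"
  shows "(a, b) \<in> {(u, v). {u, v} \<in> E \<and> u \<noteq> m \<and> v \<noteq> m}\<^sup>*"
  using assms by (auto simp: near_def)

text \<open>Suppose v is at distance 3 from x, and let a be the first vertex after x on a shortest
  path to v. Every other vertex reaches v, hence a, while avoiding x, so all neighbours of x are
  equal or adjacent to a. Applied to p and y, this yields the edge \<open>py\<close>, which would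
  put p within distance 2 of q.\<close>

lemma ecc_inner_geodesic:
  assumes d3: "\<And>u v. u \<in> V \<Longrightarrow> v \<in> V \<Longrightarrow> dist E u v \<le> enat 3"
    and pq: "\<not> dist E p q \<le> enat 2" and path: "{p, x} \<in> E" "{x, y} \<in> E" "{y, q} \<in> E"
    and v: "v \<in> V"
  shows "dist E x v \<le> enat 2"
proof (rule ccontr)
  assume far: "\<not> dist E x v \<le> enat 2"
  have nf: False if "near E x w" "near E w v" for w
    using far that dist_le_2 by metis
  have nf_pq: False if "near E p w" "near E w q" for w
    using pq that dist_le_2 by metis
  have V: "x \<in> V" "p \<in> V" "q \<in> V" using path edge_in_V by blast+
  obtain a b where ab: "near E x a" "near E a b" "near E b v"
    using d3[OF V(1) v] by (auto simp: dist_le_3)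
  have e: "{x, a} \<in> E" "{a, b} \<in> E" "{b, v} \<in> E" "x \<noteq> v" "x \<noteq> a" "x \<noteq> b"
    using nf ab by (auto simp: near_def)
  let ?r = "{(u, v). {u, v} \<in> E \<and> u \<noteq> x \<and> v \<noteq> x}"
  have to_a: "(w, a) \<in> ?r\<^sup>*" if w: "w \<in> V" "w \<noteq> x" for w
  proof -
    obtain c d where cd: "near E w c" "near E c d" "near E d v"
      using d3[OF w(1) v] by (auto simp: dist_le_3)
    \<comment> \<open>If \<open>x\<close> occurred on this walk, it would be within distance 2 of
      \<open>v\<close>.\<close>
    have "c \<noteq> x" "d \<noteq> x" using nf cd near_sym by (auto simp: near_def)
    then have "(w, c) \<in> ?r\<^sup>*" "(c, d) \<in> ?r\<^sup>*" "(d, v) \<in> ?r\<^sup>*" "(v, b) \<in> ?r\<^sup>*" "(b, a) \<in> ?r\<^sup>*"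
      using cd w e ab near_sym[OF ab(2)] near_sym[OF ab(3)]
      by (auto intro!: near_chain_linked)
    then show ?thesis by (meson rtrancl_trans)
  qed
  have px: "p \<noteq> x" "q \<noteq> x" "y \<noteq> x" using path edge_in_V nf_pq[of x] by (auto simp: near_def)
  have pa: "a = p \<or> {p, a} \<in> E"
    using adjacent_if_linked_avoiding[OF to_a[OF V(2)]] px path e by (auto simp: insert_commute)
  have "(q, a) \<in> ?r\<^sup>*" using to_a V px by blast
  moreover have "(y, q) \<in> ?r\<^sup>*" using path px by (auto intro!: near_chain_linked simp: near_def)
  ultimately have "(y, a) \<in> ?r\<^sup>*" by (rule rtrancl_trans[rotated])
  then have ya: "a = y \<or> {y, a} \<in> E"
    using adjacent_if_linked_avoiding[of y a x] px path e by auto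
  have yp: "\<not> near E p y" using nf_pq[of y] path by (auto simp: near_def)
  then have "a \<noteq> p" "a \<noteq> y" using pa ya by (auto simp: near_def insert_commute)
  then have "{p, y} \<in> E"
    using diamond[of x p y a] pa ya path e yp by (auto simp: near_def insert_commute)
  then show False using yp by (auto simp: near_def)
qed

end

section \<open>Cliques attached to a clique\<close>

text \<open>An indicator that grows must switch from 0 to 1; this reads off what a deletion has to
  change.\<close>

lemma of_bool_gain: "1 + of_bool Q \<le> (of_bool P :: nat) \<Longrightarrow> P \<and> \<not> Q"
  by (cases P; cases Q) simp_all

lemma spread_mono: "spread E d X \<Longrightarrow> E' \<subseteq> E \<Longrightarrow> spread E' d X"
  unfolding spread_def by (meson dist_antimono less_le_trans)

lemma spread_1_insert:
  "spread E 1 I \<Longrightarrow> (\<And>v. v \<in> I \<Longrightarrow> {y, v} \<notin> E) \<Longrightarrow> spread E 1 (insert y I)"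
  unfolding spread_1_iff by (metis insert_commute insert_iff)

lemma spread_subset: "spread E d X \<Longrightarrow> Y \<subseteq> X \<Longrightarrow> spread E d Y"
  unfolding spread_def by blast

text \<open>A clique B with disjoint cliques attached: a vertex v outside B lies in the clique
  represented by \<open>cp v\<close>, all of whose vertices have \<open>pr v\<close> as their only neighbour in B.\<close>
locale pendant_cliques =
  fixes V B :: "'a set" and E :: "'a set set" and pr cp :: "'a \<Rightarrow> 'a"
  assumes gr: "graph V E" and BV: "B \<subseteq> V" and card_B: "2 \<le> card B"
    and pr_in: "v \<in> V - B \<Longrightarrow> pr v \<in> B"
    and cp_in: "v \<in> V - B \<Longrightarrow> cp v \<in> V - B"
    and cp_cp: "v \<in> V - B \<Longrightarrow> cp (cp v) = cp v"
    and pr_cp: "v \<in> V - B \<Longrightarrow> pr (cp v) = pr v"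
    and edge_BB: "u \<in> B \<Longrightarrow> v \<in> B \<Longrightarrow> {u, v} \<in> E \<longleftrightarrow> u \<noteq> v"
    and edge_BA: "u \<in> B \<Longrightarrow> v \<in> V - B \<Longrightarrow> {u, v} \<in> E \<longleftrightarrow> pr v = u"
    and edge_AA: "u \<in> V - B \<Longrightarrow> v \<in> V - B \<Longrightarrow> {u, v} \<in> E \<longleftrightarrow> u \<noteq> v \<and> cp u = cp v"
begin

definition A :: "'a \<Rightarrow> 'a set" where "A x = {v \<in> V - B. pr v = x}"
definition R :: "'a set" where "R = {v \<in> V - B. cp v = v}"
definition T :: "'a set" where "T = {x \<in> B. \<exists>v\<in>A x. cp v \<noteq> v}"
text \<open>For a vertex outside B this means degree 1: its only neighbour is then
  \<open>pr v\<close>.\<close>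

definition lone :: "'a \<Rightarrow> bool" where "lone v \<longleftrightarrow> (\<forall>u\<in>V - B. cp u = cp v \<longrightarrow> u = v)"
text \<open>The colour-2 vertex placed at x. Since it is not a representative, it never collides
  with \<open>R\<close> as colour-1 class; the value is meaningful only on \<open>T\<close>.\<close>

definition spare :: "'a \<Rightarrow> 'a" where "spare x = (SOME v. v \<in> A x \<and> cp v \<noteq> v)"
text \<open>The vertex of B on which v sits. An edge joining different roots lies inside B, which is
  how walks across B are controlled.\<close>

definition rt :: "'a \<Rightarrow> 'a" where "rt v = (if v \<in> B then v else pr v)"

lemma finV [simp]: "finite V" using gr by (simp add: graph_def)
lemma finB [simp]: "finite B" using BV finV by (rule finite_subset)
lemma finA [simp]: "finite (A x)" by (simp add: A_def)
lemma finR [simp]: "finite R" by (simp add: R_def)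
lemma finT [simp]: "finite T" by (simp add: T_def)

lemma edge_in_V: "{u, v} \<in> E \<Longrightarrow> u \<in> V \<and> v \<in> V \<and> u \<noteq> v"
  using gr unfolding graph_def by (metis doubleton_eq_iff)

lemma edge_AB: "u \<in> V - B \<Longrightarrow> v \<in> B \<Longrightarrow> {u, v} \<in> E \<longleftrightarrow> pr u = v"
  using edge_BA[of v u] by (simp add: insert_commute)

lemma same_class_pr: "u \<in> V - B \<Longrightarrow> v \<in> V - B \<Longrightarrow> cp u = cp v \<Longrightarrow> pr u = pr v"
  by (metis pr_cp)

lemma rt_in: "v \<in> V \<Longrightarrow> rt v \<in> B"
  by (simp add: rt_def pr_in)

lemma near_rt: "v \<in> V \<Longrightarrow> near E v (rt v)"
  using edge_AB pr_in by (auto simp: rt_def near_def)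

lemma near_BB: "u \<in> B \<Longrightarrow> v \<in> B \<Longrightarrow> near E u v"
  by (auto simp: near_def edge_BB)

lemma dist_le_3_all: "u \<in> V \<Longrightarrow> v \<in> V \<Longrightarrow> dist E u v \<le> enat 3"
  unfolding dist_le_3 using near_rt near_BB rt_in near_sym by metis

lemma near_A: "near E u w \<Longrightarrow> u \<in> V - B \<Longrightarrow> w = pr u \<or> w \<in> V - B \<and> cp w = cp u"
  using edge_AA edge_AB edge_in_V unfolding near_def by (metis DiffI)

text \<open>Two vertices outside B have a common closed neighbour only if they sit on the same
  vertex of B. With the converse below, colour-2 sets outside B are exactly the partial transversals
  of the sets \<open>A x\<close>.\<close>

lemma spread_2_if_inj:
  assumes "J \<subseteq> V - B" "inj_on pr J"
  shows "spread E 2 J"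
  unfolding spread_2_iff
proof (intro ballI impI notI)
  fix u v assume uv: "u \<in> J" "v \<in> J" "u \<noteq> v" and "\<exists>w. near E u w \<and> near E w v"
  then obtain w where "near E u w" "near E v w" using near_sym by metis
  then have "pr u = pr v"
    using near_A[of u w] near_A[of v w] uv assms(1) pr_in pr_cp by (metis DiffD2 subsetD)
  then show False using uv assms(2) by (auto simp: inj_on_def)
qed

lemma inj_if_spread_2:
  assumes "J \<subseteq> V - B" "spread E 2 J"
  shows "inj_on pr J"
proof (rule inj_onI, rule ccontr)
  fix u v assume uv: "u \<in> J" "v \<in> J" "pr u = pr v" "u \<noteq> v"
  then have "near E u (pr u)" "near E (pr u) v"
    using assms(1) near_rt[of u] near_sym[OF near_rt[of v]] by (auto simp: rt_def subset_iff)
  then show False using assms(2) uv unfolding spread_2_iff by blast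
qed

lemma spread_2_center:
  assumes "J \<subseteq> V" "spread E 2 J" "b \<in> J" "b \<in> B"
  shows "J = {b}"
proof -
  have "v = b" if "v \<in> J" for v
    using assms that near_BB[OF assms(4) rt_in] near_rt[of v] near_sym unfolding spread_2_iff
    by (metis subsetD)
  then show ?thesis using assms by blast
qed

section \<open>Upper bound for the union of a colour-1 and a colour-2 class\<close>

lemma indep_inj_cp:
  assumes "I \<subseteq> V - B" "spread E 1 I"
  shows "inj_on cp I"
  using assms edge_AA unfolding spread_1_iff inj_on_def by (metis subsetD)

lemma cp_image_R: "I \<subseteq> V - B \<Longrightarrow> cp ` I \<subseteq> R"
  using cp_in cp_cp by (auto simp: R_def)

lemma T_iff: "x \<in> T \<longleftrightarrow> x \<in> B \<and> (\<exists>v\<in>A x. cp v \<noteq> v)"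
  by (simp add: T_def)

lemma spare: "x \<in> T \<Longrightarrow> spare x \<in> V - B \<and> pr (spare x) = x \<and> cp (spare x) \<noteq> spare x"
  using someI_ex[of "\<lambda>v. v \<in> A x \<and> cp v \<noteq> v"] unfolding spare_def T_def A_def by blast

text \<open>Over a vertex outside \<open>T\<close> every attached clique is a single vertex, so the
  part \<open>J2\<close> of J there can be charged to representatives together with I:
  \<open>cp\<close> remains injective on \<open>I \<union> J2\<close>. The part \<open>J1\<close>
  over \<open>T\<close> has at most one vertex per element of \<open>T\<close>. The set
  \<open>X\<close> makes it possible to set one vertex of B aside.\<close>

lemma class_bound:
  assumes I: "I \<subseteq> {v \<in> V - B. pr v \<in> X}" and J: "J \<subseteq> {v \<in> V - B. pr v \<in> X}"
    and "I \<inter> J = {}" "spread E 1 I" "spread E 2 J"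
  shows "card (I \<union> J) \<le> card {r \<in> R. pr r \<in> X} + card (T \<inter> X)"
proof -
  define J1 J2 where "J1 = {j \<in> J. pr j \<in> T}" and "J2 = {j \<in> J. pr j \<notin> T}"
  have JJ: "J = J1 \<union> J2" "J1 \<subseteq> J" "J2 \<subseteq> J" by (auto simp: J1_def J2_def)
  have lone: "w = j" if "j \<in> J2" "w \<in> V - B" "cp w = cp j" for w j
  proof -
    have "j \<in> V - B" using J JJ that(1) by auto
    then have "pr w = pr j" "pr j \<in> B" using same_class_pr pr_in that by metis+
    then have "cp w = w" "cp j = j"
      using that \<open>j \<in> V - B\<close> unfolding J2_def T_iff A_def by auto
    then show ?thesis using that(3) by metis
  qed
  have IJ2: "I \<union> J2 \<subseteq> {v \<in> V - B. pr v \<in> X}" using I J JJ by blast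
  have inj: "inj_on cp I" using indep_inj_cp assms(4) I by blast
  have "inj_on cp (I \<union> J2)"
  proof (intro inj_onI)
    fix u v assume uv: "u \<in> I \<union> J2" "v \<in> I \<union> J2" "cp u = cp v"
    then have "u \<in> V - B" "v \<in> V - B" using IJ2 by auto
    then show "u = v" using uv inj lone[of u v] lone[of v u] by (auto dest: inj_onD)
  qed
  moreover have "cp ` (I \<union> J2) \<subseteq> {r \<in> R. pr r \<in> X}"
    using IJ2 cp_in cp_cp pr_cp by (auto simp: R_def)
  ultimately have 1: "card (I \<union> J2) \<le> card {r \<in> R. pr r \<in> X}"
    by (intro card_inj_on_le[of cp]) auto
  have "inj_on pr J" using inj_if_spread_2 assms(5) J by blast
  then have "inj_on pr J1" using JJ inj_on_subset by blast
  moreover have "pr ` J1 \<subseteq> T \<inter> X" using J unfolding J1_def by blast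
  ultimately have 2: "card J1 \<le> card (T \<inter> X)"
    by (intro card_inj_on_le[of pr]) auto
  have "I \<union> J = (I \<union> J2) \<union> J1" using JJ by blast
  then have "card (I \<union> J) \<le> card (I \<union> J2) + card J1" by (metis card_Un_le)
  then show ?thesis using 1 2 by linarith
qed

lemma indep_two_B: "spread E 1 I \<Longrightarrow> u \<in> I \<inter> B \<Longrightarrow> v \<in> I \<inter> B \<Longrightarrow> u = v"
  using edge_BB unfolding spread_1_iff by blast

lemma indep_avoids_A:
  assumes "spread E 1 I" "y \<in> I \<inter> B" "v \<in> I" shows "v \<notin> A y"
proof
  assume "v \<in> A y"
  then have "{y, v} \<in> E" "y \<noteq> v" using assms(2) edge_BA[of y v] by (auto simp: A_def)
  then show False using assms unfolding spread_1_iff by blast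
qed

lemma A_nonempty_R: "v \<in> A y \<Longrightarrow> cp v \<in> R \<and> pr (cp v) = y"
  using cp_in cp_cp pr_cp by (auto simp: R_def A_def)

lemma R_split: "card {r \<in> R. pr r \<in> B - {y}} + card {r \<in> R. pr r = y} = card R" if "y \<in> B"
proof -
  have "R = {r \<in> R. pr r \<in> B - {y}} \<union> {r \<in> R. pr r = y}"
    using pr_in that by (auto simp: R_def)
  moreover have "card ({r \<in> R. pr r \<in> B - {y}} \<union> {r \<in> R. pr r = y}) =
    card {r \<in> R. pr r \<in> B - {y}} + card {r \<in> R. pr r = y}"
    by (intro card_Un_disjoint) auto
  ultimately show ?thesis by simp
qed

text \<open>The account at y when y itself is in I: then I avoids \<open>A y\<close> and J has at
  most one vertex there, so the left side is the most that is used. The right side is the allowance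
  of the general bound at y, including its bonus.\<close>

lemma local_gain:
  assumes "y \<in> B"
  shows "1 + of_bool (A y \<noteq> {}) \<le>
    card {r \<in> R. pr r = y} + card (T \<inter> {y}) + of_bool (card (A y) \<le> 1)"
proof (cases "y \<in> T")
  case True
  then obtain v where "v \<in> A y" using T_iff by blast
  then have "card {r \<in> R. pr r = y} > 0" using A_nonempty_R by (auto simp: card_gt_0_iff)
  then show ?thesis using True by auto
next
  case False
  then have "A y = {r \<in> R. pr r = y}" using assms unfolding T_iff A_def R_def by auto
  moreover have "card (A y) > 0" if "A y \<noteq> {}" using that by (simp add: card_gt_0_iff)
  ultimately show ?thesis by (cases "A y = {}") auto
qed

text \<open>The disjunction follows the position of J: if J meets B it is a single vertex, otherwise
  it is charged to \<open>R\<close> and \<open>T\<close>. I has at most one vertex in B, and this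
  vertex is the source of the bonus term.\<close>

lemma packing_bound:
  assumes "I \<subseteq> V" "J \<subseteq> V" "I \<inter> J = {}" "spread E 1 I" "spread E 2 J"
  shows "card (I \<union> J) \<le> card R + card T + of_bool (\<exists>x\<in>B. card (A x) \<le> 1)
    \<or> card (I \<union> J) \<le> 1 + card R + of_bool (\<exists>x\<in>B. A x = {})"
proof (cases "J \<inter> B = {}")
  case JB: True
  then have JV: "J \<subseteq> {v \<in> V - B. pr v \<in> B}" using assms pr_in by blast
  show ?thesis
  proof (cases "I \<inter> B = {}")
    case True
    then have "I \<subseteq> {v \<in> V - B. pr v \<in> B}" using assms pr_in by blast
    then have "card (I \<union> J) \<le> card {r \<in> R. pr r \<in> B} + card (T \<inter> B)"
      using class_bound assms JV by blast
    moreover have "{r \<in> R. pr r \<in> B} = R" using pr_in by (auto simp: R_def)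
    moreover have "T \<inter> B = T" by (auto simp: T_def)
    ultimately show ?thesis by simp
  next
    case False
    then obtain y where y: "y \<in> I" "y \<in> B" by blast
    have IB: "I \<inter> B = {y}" using indep_two_B[OF assms(4)] y by blast
    \<comment> \<open>Everything at y is set aside and accounted for by \<open>local_gain\<close>;
      the rest lives over \<open>B - {y}\<close>.\<close>
    let ?I = "I - {y}" and ?J = "J - A y"
    have I': "?I \<subseteq> {v \<in> V - B. pr v \<in> B - {y}}"
      using indep_avoids_A[OF assms(4), of y] y IB assms(1) pr_in by (auto simp: A_def)
    have J': "?J \<subseteq> {v \<in> V - B. pr v \<in> B - {y}}"
      using JV by (auto simp: A_def)
    have "spread E 1 ?I" "spread E 2 ?J" using assms by (auto simp: spread_def)
    then have 1: "card (?I \<union> ?J) \<le> card {r \<in> R. pr r \<in> B - {y}} + card (T \<inter> (B - {y}))"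
      using class_bound[OF I' J'] assms(3) by blast
    have "card (J \<inter> A y) \<le> 1"
      using inj_if_spread_2[of J] JV assms(5)
      by (subst card_le_Suc0_iff_eq[folded One_nat_def]) (auto simp: A_def inj_on_def)
    then have 2: "card (J \<inter> A y) \<le> of_bool (A y \<noteq> {})" by auto
    have "card (I \<union> J) \<le> card (?I \<union> ?J) + card ({y} \<union> (J \<inter> A y))"
      using card_Un_le[of "?I \<union> ?J" "{y} \<union> (J \<inter> A y)"] y
      by (auto intro: back_subst[of "\<lambda>S. card S \<le> _"])
    moreover have "card ({y} \<union> (J \<inter> A y)) \<le> 1 + card (J \<inter> A y)"
      using card_Un_le[of "{y}"] by simp
    moreover have "card T = card (T \<inter> (B - {y})) + card (T \<inter> {y})"
      by (subst card_Un_disjoint[symmetric])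
        (auto intro: arg_cong[of _ _ card] simp: T_def)
    moreover have "of_bool (card (A y) \<le> 1) \<le> (of_bool (\<exists>x\<in>B. card (A x) \<le> 1) :: nat)"
      using y by auto
    ultimately show ?thesis
      using 1 2 local_gain[OF y(2)] R_split[OF y(2)] by linarith
  qed
next
  case False
  then obtain b where b: "b \<in> J" "b \<in> B" by blast
  then have J: "J = {b}" using spread_2_center assms by blast
  have "card (I - B) \<le> card R"
    using indep_inj_cp[of "I - B"] cp_image_R[of "I - B"] assms
    by (intro card_inj_on_le[of cp]) (auto simp: spread_def)
  have "card I \<le> card R + of_bool (\<exists>x\<in>B. A x = {})"
  proof (cases "I \<inter> B = {}")
    case True
    then have "I - B = I" by blast
    then show ?thesis using \<open>card (I - B) \<le> card R\<close> by simp
  next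
    case False
    then obtain y where y: "y \<in> I" "y \<in> B" by blast
    have IB: "I = insert y (I - B)" using indep_two_B[OF assms(4)] y by blast
    have cI: "card I \<le> 1 + card (I - B)"
      by (subst IB) (simp add: card_insert_if finite_subset[OF assms(1)])
    show ?thesis
    proof (cases "A y = {}")
      case True
      then show ?thesis using cI \<open>card (I - B) \<le> card R\<close> y by auto
    next
      case False
      then obtain v where v: "v \<in> A y" by blast
      \<comment> \<open>With y in I, no vertex of \<open>A y\<close> is in I, so the representative
        \<open>cp v\<close> is not hit: y adds one vertex and costs one.\<close>
      have "cp ` (I - B) \<subseteq> R - {cp v}"
      proof -
        have "cp u \<noteq> cp v" if "u \<in> I - B" for u
          using that indep_avoids_A[OF assms(4), of y u] y v same_class_pr[of u v] assms(1)
          by (auto simp: A_def)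
        moreover have "cp ` (I - B) \<subseteq> R" by (rule cp_image_R) (use assms(1) in blast)
        ultimately show ?thesis by auto
      qed
      then have "card (I - B) \<le> card (R - {cp v})"
        using indep_inj_cp[of "I - B"] assms by (intro card_inj_on_le[of cp]) (auto simp: spread_def)
      moreover have "cp v \<in> R" using v A_nonempty_R by blast
      ultimately have "card (I - B) + 1 \<le> card R" using card_Suc_Diff1[OF finR] by fastforce
      then show ?thesis using cI by linarith
    qed
  qed
  moreover have "card (I \<union> J) \<le> card I + 1" using J card_Un_le[of I J] by simp
  ultimately show ?thesis by linarith
qed

section \<open>Choices that attain the bound\<close>

lemma spread_R: "spread E 1 R"
  unfolding spread_1_iff R_def using edge_AA by auto

lemma R_sub: "R \<subseteq> V - B"
  by (auto simp: R_def)

lemma spare_image: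
  assumes "X \<subseteq> T"
  shows "spare ` X \<subseteq> V - B - R" "inj_on pr (spare ` X)" "card (spare ` X) = card X"
proof -
  have *: "spare x \<in> V - B" "pr (spare x) = x" "spare x \<notin> R" if "x \<in> X" for x
    using spare[of x] assms that by (auto simp: R_def)
  then show "spare ` X \<subseteq> V - B - R" by blast
  show "inj_on pr (spare ` X)" using *(2) by (auto simp: inj_on_def)
  have "inj_on spare X" using *(2) by (metis inj_onI)
  then show "card (spare ` X) = card X" by (rule card_image)
qed

text \<open>For the bonus a vertex y of B joins I. Without outer neighbours this is free; with
  exactly one, l, the vertex l moves from colour 1 to colour 2, where the place at y is empty
  because y is not in \<open>T\<close>.\<close>

lemma packing_exists_spread:
  "\<exists>I J. I \<subseteq> V \<and> J \<subseteq> V \<and> I \<inter> J = {} \<and> spread E 1 I \<and> spread E 2 J \<and>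
    card (I \<union> J) = card R + card T + of_bool (\<exists>x\<in>B. card (A x) \<le> 1)"
proof -
  note s = spare_image[OF subset_refl]
  have un: "card (R \<union> spare ` T) = card R + card T"
    using s by (subst card_Un_disjoint) auto
  consider "\<forall>x\<in>B. \<not> card (A x) \<le> 1" | y where "y \<in> B" "A y = {}"
    | y l where "y \<in> B" "A y = {l}"
    by (metis One_nat_def card_0_eq card_1_singletonE finA le_Suc_eq le_zero_eq)
  then show ?thesis
  proof cases
    case 1
    then have "\<not> (\<exists>x\<in>B. card (A x) \<le> 1)" by blast
    then show ?thesis using s un spread_R spread_2_if_inj[of "spare ` T"] R_sub
      by (intro exI[of _ R] exI[of _ "spare ` T"]) auto
  next
    case 2
    then have *: "\<exists>x\<in>B. card (A x) \<le> 1" by (metis card.empty zero_le)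
    have "{y, v} \<notin> E" if "v \<in> R" for v using that edge_BA[OF 2(1), of v] R_sub 2(2) by (auto simp: A_def)
    then have "spread E 1 (insert y R)" using spread_R by (intro spread_1_insert)
    moreover have "card (insert y R \<union> spare ` T) = card R + card T + 1"
      using un s R_sub 2 by (simp add: card_insert_if) blast
    moreover have "insert y R \<inter> spare ` T = {}" using s 2 by blast
    ultimately show ?thesis using s un * spread_2_if_inj[of "spare ` T"] R_sub 2 BV
      by (intro exI[of _ "insert y R"] exI[of _ "spare ` T"]) auto
  next
    case 3
    then have *: "\<exists>x\<in>B. card (A x) \<le> 1" by (intro bexI[of _ y]) simp_all
    have l: "l \<in> R" "pr l = y" "l \<in> V - B"
      using 3 A_nonempty_R[of l y] by (auto simp: A_def R_def)
    have yT: "y \<notin> T" using 3 l by (auto simp: T_iff R_def)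
    have "v = l" if "v \<in> V - B" "pr v = y" for v using 3 that by (auto simp: A_def)
    then have "{y, v} \<notin> E" if "v \<in> R - {l}" for v using that edge_BA[OF 3(1), of v] R_sub by blast
    then have "spread E 1 (insert y (R - {l}))"
      using spread_subset[OF spread_R, of "R - {l}"] by (intro spread_1_insert) auto
    moreover have "inj_on pr (insert l (spare ` T))"
      using s l yT spare by (auto simp: inj_on_def)
    then have "spread E 2 (insert l (spare ` T))" using s l by (intro spread_2_if_inj) auto
    moreover have "insert y (R - {l}) \<union> insert l (spare ` T) = insert y (R \<union> spare ` T)"
      using l by blast
    moreover have "y \<notin> R \<union> spare ` T" using 3 s R_sub by blast
    then have "card (insert y (R \<union> spare ` T)) = card R + card T + 1" using un by simp
    moreover have "insert y (R - {l}) \<inter> insert l (spare ` T) = {}"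
      using l 3 s R_sub by blast
    moreover have "insert y (R - {l}) \<subseteq> V" "insert l (spare ` T) \<subseteq> V"
      using 3 BV R_sub s l by blast+
    ultimately show ?thesis using *
      by (intro exI[of _ "insert y (R - {l})"] exI[of _ "insert l (spare ` T)"]) simp
  qed
qed

text \<open>Since B has at least two vertices, the colour-2 vertex b can differ from the bare vertex
  that joins I.\<close>

lemma packing_exists_center:
  "\<exists>I J. I \<subseteq> V \<and> J \<subseteq> V \<and> I \<inter> J = {} \<and> spread E 1 I \<and> spread E 2 J \<and>
    card (I \<union> J) = 1 + card R + of_bool (\<exists>x\<in>B. A x = {})"
proof (cases "\<exists>x\<in>B. A x = {}")
  case True
  then obtain y where y: "y \<in> B" "A y = {}" by blast
  have "\<not> B \<subseteq> {y}" using card_B card_mono[of "{y}" B] by auto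
  then obtain b where b: "b \<in> B" "b \<noteq> y" by blast
  have "{y, v} \<notin> E" if "v \<in> R" for v using that edge_BA[OF y(1), of v] R_sub y(2) by (auto simp: A_def)
  then have "spread E 1 (insert y R)" using spread_R by (intro spread_1_insert)
  moreover have "b \<notin> insert y R" "y \<notin> R" using b y R_sub by auto
  moreover have "spread E 2 {b}" by (simp add: spread_def)
  ultimately show ?thesis using True b y BV R_sub
    by (intro exI[of _ "insert y R"] exI[of _ "{b}"]) auto
next
  case False
  obtain b where b: "b \<in> B" using card_B by fastforce
  then have "b \<notin> R" "spread E 2 {b}" using R_sub by (auto simp: spread_def)
  then show ?thesis using False b spread_R BV R_sub
    by (intro exI[of _ R] exI[of _ "{b}"]) auto
qed

lemma chromatic_upper_spread:
  "packing_chromatic V E + (card R + card T + of_bool (\<exists>x\<in>B. card (A x) \<le> 1)) \<le> card V + 2"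
proof -
  obtain I J where "I \<subseteq> V" "J \<subseteq> V" "I \<inter> J = {}" "spread E 1 I" "spread E 2 J"
    "card (I \<union> J) = card R + card T + of_bool (\<exists>x\<in>B. card (A x) \<le> 1)"
    using packing_exists_spread by blast
  then show ?thesis using chromatic_le_two_classes[of V I J E] by simp
qed

lemma chromatic_upper_center:
  "packing_chromatic V E + (1 + card R + of_bool (\<exists>x\<in>B. A x = {})) \<le> card V + 2"
proof -
  obtain I J where "I \<subseteq> V" "J \<subseteq> V" "I \<inter> J = {}" "spread E 1 I" "spread E 2 J"
    "card (I \<union> J) = 1 + card R + of_bool (\<exists>x\<in>B. A x = {})"
    using packing_exists_center by blast
  then show ?thesis using chromatic_le_two_classes[of V I J E] by simp
qed

lemma two_in_B: obtains a b where "a \<in> B" "b \<in> B" "a \<noteq> b"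
proof -
  have "\<not> is_singleton B" "B \<noteq> {}" using card_B by (auto simp: is_singleton_altdef)
  then show ?thesis using that by (metis all_not_in_conv is_singletonI')
qed

lemma chromatic_lower:
  "card V + 2 \<le> packing_chromatic V E + card R + card T + of_bool (\<exists>x\<in>B. card (A x) \<le> 1)
   \<or> card V + 2 \<le> packing_chromatic V E + 1 + card R + of_bool (\<exists>x\<in>B. A x = {})"
proof -
  obtain a b where ab: "a \<in> B" "b \<in> B" "a \<noteq> b" by (rule two_in_B)
  obtain I J where IJ: "I \<subseteq> V" "J \<subseteq> V" "I \<inter> J = {}" "spread E 1 I" "spread E 2 J"
    "card V + 2 \<le> packing_chromatic V E + card (I \<union> J)"
    by (rule chromatic_ge_two_classes[OF finV dist_le_3_all, of a b]) (use ab BV edge_BB in auto)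
  then show ?thesis using packing_bound[OF IJ(1-5)] by linarith
qed

section \<open>Necessary conditions\<close>

lemma cp_of_lone: "l \<in> V - B \<Longrightarrow> lone l \<Longrightarrow> cp l = l"
  using cp_in cp_cp unfolding lone_def by metis

text \<open>No other vertex has l as representative, so \<open>pr\<close> and \<open>cp\<close>
  still describe the smaller graph and all bounds apply to it.\<close>

lemma delete_lone:
  assumes "l \<in> V - B" "lone l"
  shows "pendant_cliques (V - {l}) B {e \<in> E. l \<notin> e} pr cp"
proof
  show "graph (V - {l}) {e \<in> E. l \<notin> e}" using gr unfolding graph_def by fastforce
  show "cp v \<in> V - {l} - B" if "v \<in> V - {l} - B" for v
    using that cp_in[of v] cp_cp[of v] assms cp_of_lone[OF assms] unfolding lone_def by auto
qed (use assms BV card_B pr_in cp_cp pr_cp edge_BB edge_BA edge_AA in auto)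

text \<open>The sizes of \<open>V\<close> and \<open>R\<close> both drop by one and \<open>T\<close>
  stays, so the chromatic number falls only if a bonus term switches on at \<open>pr l\<close>.
  Which of the two bounds it belongs to decides between two and one outer neighbours; comparison
  with the other choice then settles \<open>T\<close>.\<close>

lemma critical_lone:
  assumes crit: "packing_critical V E" and l: "l \<in> V - B" "lone l"
  shows "((\<forall>x\<in>B. 2 \<le> card (A x)) \<and> card (A (pr l)) = 2 \<and> T \<noteq> {})
    \<or> ((\<forall>x\<in>B. A x \<noteq> {}) \<and> card (A (pr l)) = 1 \<and> T = {})"
proof -
  let ?V = "V - {l}" and ?E = "{e \<in> E. l \<notin> e}"
  interpret H: pendant_cliques ?V B ?E pr cp using delete_lone[OF l] .
  have "proper_subgraph ?V ?E V E" using H.gr l by (auto simp: proper_subgraph_def)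
  then have less: "packing_chromatic ?V ?E < packing_chromatic V E"
    using crit by (auto simp: packing_critical_def)
  have HA: "H.A x = A x - {l}" for x by (auto simp: H.A_def A_def)
  have HT: "card H.T = card T"
    using cp_of_lone[OF l] by (auto simp: H.T_iff T_iff HA intro!: arg_cong[of _ _ card])
  have "H.R = R - {l}" by (auto simp: H.R_def R_def)
  moreover have "l \<in> R" using cp_of_lone l by (auto simp: R_def)
  ultimately have HR: "card R = card H.R + 1" using card_Suc_Diff1[OF finR, of l] by simp
  have cV: "card V = card ?V + 1" using l card_Suc_Diff1[OF finV, of l] by simp
  have y: "pr l \<in> B" "l \<in> A (pr l)" using l pr_in by (auto simp: A_def)
  have other: "A x - {l} = A x" if "x \<noteq> pr l" for x using that by (auto simp: A_def)
  have cy: "card (A (pr l)) = card (A (pr l) - {l}) + 1" using y card_Suc_Diff1[OF finA, of l] by simp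
  show ?thesis
    using H.chromatic_lower
  proof
    assume *: "card ?V + 2 \<le> packing_chromatic ?V ?E + card H.R + card H.T +
      of_bool (\<exists>x\<in>B. card (H.A x) \<le> 1)"
    then have "1 + of_bool (\<exists>x\<in>B. card (A x) \<le> 1) \<le>
        (of_bool (\<exists>x\<in>B. card (H.A x) \<le> 1) :: nat)"
      using chromatic_upper_spread less cV HR HT by linarith
    then have s: "\<exists>x\<in>B. card (H.A x) \<le> 1" "\<not> (\<exists>x\<in>B. card (A x) \<le> 1)"
      using of_bool_gain by blast+
    \<comment> \<open>With \<open>T\<close> empty, placing J inside B would need no more colours
      before the deletion than are needed after it.\<close>
    have "card T > 0"
      using * chromatic_upper_center less cV HR HT s(1) by (simp only: of_bool_eq)
    obtain x where x: "x \<in> B" "card (A x - {l}) \<le> 1" using s(1) HA by auto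
    then have "x = pr l" using s(2) other by metis
    then have "card (A (pr l)) \<le> 2" using x cy by simp
    moreover have "\<forall>x\<in>B. 2 \<le> card (A x)" using s(2) by force
    ultimately show ?thesis using \<open>card T > 0\<close> y(1) by (metis card_gt_0_iff le_antisym)
  next
    assume *: "card ?V + 2 \<le> packing_chromatic ?V ?E + 1 + card H.R + of_bool (\<exists>x\<in>B. H.A x = {})"
    then have "1 + of_bool (\<exists>x\<in>B. A x = {}) \<le> (of_bool (\<exists>x\<in>B. H.A x = {}) :: nat)"
      using chromatic_upper_center less cV HR by linarith
    then have e: "\<exists>x\<in>B. H.A x = {}" "\<not> (\<exists>x\<in>B. A x = {})"
      using of_bool_gain by blast+
    obtain x where x: "x \<in> B" "A x - {l} = {}" using e(1) HA by metis
    then have "x = pr l" using e(2) other by metis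
    then have c1: "card (A (pr l)) = 1" using x cy by simp
    then have "\<exists>x\<in>B. card (A x) \<le> 1" using y by (metis order_refl)
    \<comment> \<open>The root with one outer neighbour gives the other choice its bonus already
      before the deletion; an element of \<open>T\<close> would then leave no room for a
      drop.\<close>
    then have "card T = 0"
      using * chromatic_upper_spread e(1) less cV HR by (simp only: of_bool_eq)
    then show ?thesis using c1 e(2) by simp
  qed
qed

text \<open>Cutting the outer edge of a pendant triangle turns one attached clique into two single
  vertices, each its own representative; so the shape of the graph is kept.\<close>

lemma delete_triangle_edge:
  assumes "x \<in> B" "A x = {u, v}" "u \<noteq> v" "cp u = cp v"
  shows "pendant_cliques V B (E - {{u, v}}) pr (cp(u := u, v := v))"
proof -
  have uv: "u \<in> V - B" "v \<in> V - B" "pr u = x" "pr v = x" using assms(2) by (auto simp: A_def)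
  have mem: "w \<in> {u, v}" if "w \<in> V - B" "pr w = x" for w
    using that assms(2) unfolding A_def by blast
  have cls: "w \<in> {u, v}" if "w \<in> V - B" "cp w \<in> {u, v}" for w
    using that pr_cp[of w] uv(3,4) mem[of w] by (metis insertE singletonD)
  have cpu: "cp u \<in> {u, v}" using mem[of "cp u"] cp_in[OF uv(1)] pr_cp[OF uv(1)] uv(3) by metis
  show ?thesis
  proof
    show "graph V (E - {{u, v}})" using gr by (auto simp: graph_def)
    fix w assume w: "w \<in> V - B"
    show "(cp(u := u, v := v)) w \<in> V - B" using cp_in[OF w] uv by auto
    show "(cp(u := u, v := v)) ((cp(u := u, v := v)) w) = (cp(u := u, v := v)) w"
      using cp_cp[OF w] cls[OF w] by auto
    show "pr ((cp(u := u, v := v)) w) = pr w" using pr_cp[OF w] by auto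
    fix w' assume w': "w' \<in> V - B"
    show "{w, w'} \<in> E - {{u, v}} \<longleftrightarrow>
        w \<noteq> w' \<and> (cp(u := u, v := v)) w = (cp(u := u, v := v)) w'"
    proof (cases "w \<in> {u, v} \<or> w' \<in> {u, v}")
      case True
      have "cp w \<notin> {u, v}" if "w \<notin> {u, v}" using cls[OF w] that by blast
      moreover have "cp w' \<notin> {u, v}" if "w' \<notin> {u, v}" using cls[OF w'] that by blast
      ultimately show ?thesis using True edge_AA[OF w w'] cpu assms(3,4)
        by (auto simp: doubleton_eq_iff)
    next
      case False
      then show ?thesis using edge_AA[OF w w'] by (auto simp: doubleton_eq_iff)
    qed
  qed (use BV card_B pr_in edge_BB edge_BA uv in \<open>auto simp: doubleton_eq_iff\<close>)
qed

text \<open>\<open>R\<close> gains one and \<open>T\<close> loses x, so the value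
  \<open>card R + card T\<close> is unchanged. Only the choice with J inside B improves, to
  \<open>card R + 2\<close> in terms of the old \<open>R\<close>, and this is larger only if
  \<open>card T \<le> 1\<close>.\<close>

lemma critical_triangle:
  assumes crit: "packing_critical V E" and thick: "\<And>x. x \<in> B \<Longrightarrow> 2 \<le> card (A x)"
    and x: "x \<in> B" "A x = {u, v}" "u \<noteq> v" "cp u = cp v"
  shows "T = {x}"
proof -
  let ?E = "E - {{u, v}}" and ?cp = "cp(u := u, v := v)"
  interpret H: pendant_cliques V B ?E pr ?cp using delete_triangle_edge[OF x] .
  have uv: "u \<in> V - B" "v \<in> V - B" "pr u = x" "pr v = x" using x(2) by (auto simp: A_def)
  have uvE: "{u, v} \<in> E" using edge_AA uv x by blast
  have "proper_subgraph V ?E V E" using H.gr uvE by (auto simp: proper_subgraph_def)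
  then have less: "packing_chromatic V ?E < packing_chromatic V E"
    using crit by (auto simp: packing_critical_def)
  have mem: "w \<in> {u, v}" if "w \<in> V - B" "pr w = x" for w
    using that x(2) unfolding A_def by blast
  have cpu: "cp u \<in> {u, v}" using mem[of "cp u"] cp_in[OF uv(1)] pr_cp[OF uv(1)] uv(3) by metis
  have xT: "x \<in> T" using cpu x by (auto simp: T_iff)
  have HT: "H.T = T - {x}"
  proof -
    have "z \<in> H.T \<longleftrightarrow> z \<in> T - {x}" if "z \<in> B" for z
    proof (cases "z = x")
      case True
      have "z \<notin> H.T" unfolding H.T_iff True x(2) by simp
      then show ?thesis using True by blast
    next
      case False
      then have "w \<notin> {u, v}" if "w \<in> A z" for w using that uv by (auto simp: A_def)
      then show ?thesis using False by (auto simp: H.T_iff T_iff)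
    qed
    moreover have "H.T \<subseteq> B" "T \<subseteq> B" unfolding H.T_def T_def by blast+
    ultimately show ?thesis by blast
  qed
  \<comment> \<open>The end of the deleted edge that was not the representative; it is the new
    element of \<open>R\<close>.\<close>
  obtain w where w: "w \<in> {u, v}" "w \<noteq> cp u" using x(3) by blast
  have cpw: "cp w = cp u" using w(1) x(4) by auto
  have "z \<in> H.R \<longleftrightarrow> z \<in> insert w R" if z: "z \<in> V - B" for z
  proof (cases "z \<in> {u, v}")
    case True
    then have "z = w \<or> z = cp u" using w cpu x(3) by auto
    moreover have "cp (cp u) = cp u" using cp_cp uv(1) by blast
    ultimately show ?thesis using z True by (auto simp: H.R_def R_def)
  next
    case False
    then have "z \<noteq> w" "?cp z = cp z" using w(1) by auto
    then show ?thesis using z by (auto simp: H.R_def R_def)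
  qed
  moreover have "w \<in> V - B" using w(1) uv by blast
  ultimately have "H.R = insert w R" using R_sub H.R_sub by blast
  moreover have "w \<notin> R" using w(2) cpw by (simp add: R_def)
  ultimately have HR: "card H.R = card R + 1" by simp
  have HT': "card T = card H.T + 1" using xT HT card_Suc_Diff1[OF finT, of x] by simp
  have no: "\<not> (\<exists>x\<in>B. card (A x) \<le> 1)" "\<not> (\<exists>x\<in>B. A x = {})"
    by (auto dest!: thick)
  have "card T \<le> 1"
    using H.chromatic_lower
  proof
    assume "card V + 2 \<le> packing_chromatic V ?E + card H.R + card H.T +
      of_bool (\<exists>x\<in>B. card (A x) \<le> 1)"
    then show ?thesis using chromatic_upper_spread less HR HT' no(1) by simp
  next
    assume "card V + 2 \<le> packing_chromatic V ?E + 1 + card H.R + of_bool (\<exists>x\<in>B. A x = {})"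
    then show ?thesis using chromatic_upper_spread less HR no(2) by simp
  qed
  then have "\<forall>a\<in>T. \<forall>b\<in>T. a = b" using card_le_Suc0_iff_eq[OF finT] by simp
  then show ?thesis using xT by blast
qed

text \<open>The deleted edge lies in B, so the shape is lost and the lower bound is redone by hand.
  The detour over z keeps all distances at most 3. A drop would need a union larger than
  \<open>card R + 1 + card T\<close>, but I exceeds \<open>R\<close> by at most one, and J has at
  most \<open>card T\<close> vertices, where \<open>card T \<ge> 2\<close> covers the case that J
  meets B.\<close>

lemma critical_bare:
  assumes crit: "packing_critical V E" and x: "x \<in> B" "A x = {}"
    and nolone: "\<And>v. v \<in> V - B \<Longrightarrow> \<not> lone v"
    and yz: "y \<in> B" "z \<in> B" "y \<noteq> z" "A y \<noteq> {}" "A z \<noteq> {}"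
  shows False
proof -
  let ?E = "E - {{x, y}}"
  have xyz: "x \<noteq> y" "x \<noteq> z" using x yz by auto
  have "proper_subgraph V ?E V E"
    using gr x yz xyz edge_BB[of x y] by (auto simp: proper_subgraph_def graph_def)
  then have less: "packing_chromatic V ?E < packing_chromatic V E"
    using crit by (auto simp: packing_critical_def)
  have n1: "near ?E v (rt v)" if "v \<in> V" for v
    using near_rt[OF that] x(1) yz(1) by (auto simp: near_def rt_def doubleton_eq_iff)
  have n2: "near ?E a b" if "a \<in> B" "b \<in> B" "{a, b} \<noteq> {x, y}" for a b
    using that edge_BB by (auto simp: near_def)
  have rx: "v = x" if "v \<in> V" "rt v = x" for v
    using that x by (auto simp: rt_def A_def split: if_splits)
  have xz: "near ?E x z" "near ?E z x" "near ?E z y" "near ?E y z"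
    using n2 x yz xyz by (auto simp: doubleton_eq_iff)
  \<comment> \<open>Only x has root x, so the missing edge matters only between x and vertices with
    root y; their route is x, z, y, v.\<close>
  have d3: "dist ?E u v \<le> enat 3" if uv: "u \<in> V" "v \<in> V" for u v
  proof -
    consider "{rt u, rt v} \<noteq> {x, y}" | "u = x" "rt v = y" | "rt u = y" "v = x"
      using rx[OF uv(1)] rx[OF uv(2)] by (auto simp: doubleton_eq_iff)
    then show ?thesis
    proof cases
      case 1
      then show ?thesis unfolding dist_le_3
        using n1[OF uv(1)] near_sym[OF n1[OF uv(2)]] n2[OF rt_in[OF uv(1)] rt_in[OF uv(2)]] by blast
    next
      case 2
      then show ?thesis unfolding dist_le_3 using near_sym[OF n1[OF uv(2)]] xz by auto
    next
      case 3
      then show ?thesis unfolding dist_le_3 using n1[OF uv(1)] xz by auto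
    qed
  qed
  obtain I J where IJ: "I \<subseteq> V" "J \<subseteq> V" "I \<inter> J = {}" "spread ?E 1 I" "spread ?E 2 J"
    "card V + 2 \<le> packing_chromatic V ?E + card (I \<union> J)"
    by (rule chromatic_ge_two_classes[OF finV d3, of x z])
      (use x yz xyz BV edge_BB[of x z] in \<open>auto simp: doubleton_eq_iff\<close>)
  have fin: "finite I" "finite J" using IJ finV finite_subset by blast+
  have edge_A: "{u, v} \<in> ?E \<longleftrightarrow> u \<noteq> v \<and> cp u = cp v" if "u \<in> V - B" "v \<in> V - B" for u v
    using edge_AA[OF that] that x(1) by (auto simp: doubleton_eq_iff)
  have inj: "inj_on cp (I - B)"
  proof (rule inj_onI, rule ccontr)
    fix u v assume uv: "u \<in> I - B" "v \<in> I - B" "cp u = cp v" "u \<noteq> v"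
    then have "{u, v} \<in> ?E" using edge_A[of u v] IJ(1) by blast
    then show False using IJ(4) uv unfolding spread_1_iff by blast
  qed
  have img: "cp ` (I - B) \<subseteq> R" by (rule cp_image_R) (use IJ(1) in blast)
  have cI: "card I \<le> card (I - B) + card (I \<inter> B)"
    using card_Un_le[of "I - B" "I \<inter> B"] by (simp add: Un_Diff_Int)
  have cardI: "card I \<le> card R + 1"
  \<comment> \<open>Now nonadjacent, x and y may both be in I, but then \<open>A y\<close> is closed
    to I and one representative is lost.\<close>
  proof (cases "x \<in> I \<and> y \<in> I")
    case True
    have "I \<inter> B \<subseteq> {x, y}"
      using IJ(4) True edge_BB yz(1) unfolding spread_1_iff by (auto simp: doubleton_eq_iff)
    then have 2: "card (I \<inter> B) \<le> 2" using card_mono[of "{x, y}" "I \<inter> B"] xyz by simp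
    obtain v where v: "v \<in> A y" using yz by blast
    have "cp u \<noteq> cp v" if "u \<in> I - B" for u
    proof
      assume "cp u = cp v"
      then have "pr u = y" using same_class_pr[of u v] that IJ(1) v by (auto simp: A_def)
      then have "{y, u} \<in> E" using edge_BA[of y u] yz(1) that IJ(1) by auto
      then show False using IJ(4) True that x(1) yz(1) unfolding spread_1_iff
        by (auto simp: doubleton_eq_iff)
    qed
    then have "cp ` (I - B) \<subseteq> R - {cp v}" using img by auto
    then have "card (I - B) \<le> card (R - {cp v})" using inj by (intro card_inj_on_le[of cp]) auto
    moreover have "cp v \<in> R" using v A_nonempty_R by blast
    ultimately have "card (I - B) + 1 \<le> card R" using card_Suc_Diff1[OF finR] by fastforce
    then show ?thesis using cI 2 by linarith
  next
    case False
    have "a = b" if "a \<in> I \<inter> B" "b \<in> I \<inter> B" for a b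
      using IJ(4) that False edge_BB[of a b] unfolding spread_1_iff by (auto simp: doubleton_eq_iff)
    then have "card (I \<inter> B) \<le> 1" using fin by (simp add: card_le_Suc0_iff_eq)
    moreover have "card (I - B) \<le> card R" using inj img by (intro card_inj_on_le[of cp]) auto
    ultimately show ?thesis using cI by linarith
  qed
  have inT: "w \<in> T" if "w \<in> B" "v \<in> A w" for w v
  proof -
    have "v \<in> V - B" using that by (auto simp: A_def)
    then obtain u where u: "u \<in> V - B" "cp u = cp v" "u \<noteq> v" using nolone unfolding lone_def by blast
    then have "u \<in> A w" using same_class_pr[of u v] that by (auto simp: A_def)
    then have "cp u \<noteq> u \<or> cp v \<noteq> v" using u by metis
    then show ?thesis using that \<open>u \<in> A w\<close> unfolding T_iff by blast
  qed
  have T2: "2 \<le> card T"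
    using inT yz card_mono[of T "{y, z}"] by fastforce
  have prJ: "inj_on pr (J - B)"
  proof (rule inj_onI, rule ccontr)
    fix u v assume uv: "u \<in> J - B" "v \<in> J - B" "pr u = pr v" "u \<noteq> v"
    then have "near ?E u (pr u)" "near ?E (pr u) v"
      using IJ(2) n1[of u] near_sym[OF n1[of v]] by (auto simp: rt_def)
    then show False using IJ(5) uv unfolding spread_2_iff by blast
  qed
  have cardJ: "card J \<le> card T"
  proof (cases "J \<inter> B = {}")
    case True
    then have "J - B = J" by blast
    moreover have "pr ` (J - B) \<subseteq> T" using IJ(2) inT pr_in by (auto simp: A_def)
    ultimately show ?thesis using prJ by (metis card_inj_on_le finT)
  next
    case False
    then obtain b where b: "b \<in> J" "b \<in> B" by blast
    have far: "v = b" if "v \<in> J" "near ?E b w" "near ?E w v" for v w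
      using IJ(5) b that unfolding spread_2_iff by metis
    \<comment> \<open>A vertex of B is still within distance 2 of everything, except x from the
      vertices of \<open>A y\<close>.\<close>
    have "v \<in> insert b (A y)" if vJ: "v \<in> J" for v
    proof (cases "{b, rt v} = {x, y}")
      case True
      then consider "v = x" "b = y" | "b = x" "rt v = y"
        using rx[of v] vJ IJ(2) by (auto simp: doubleton_eq_iff)
      then show ?thesis
      proof cases
        case 1
        then show ?thesis using far[OF vJ] xz by blast
      next
        case 2
        show ?thesis
        proof (cases "v = y")
          case True
          then show ?thesis using far[OF vJ] xz 2 by blast
        next
          case False
          then show ?thesis using 2 vJ IJ(2) by (auto simp: rt_def A_def split: if_splits)
        qed
      qed
    next
      case False
      then show ?thesis using far[OF vJ n2] b rt_in[of v] near_sym[OF n1[of v]] vJ IJ(2) by blast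
    qed
    then have "J \<subseteq> insert b (J \<inter> A y)" by blast
    then have "card J \<le> 1 + card (J \<inter> A y)"
      using fin
      by (metis (no_types, lifting) card_insert_if card_mono finite_Int finite_insert le_Suc_eq
          plus_1_eq_Suc)
    moreover have "card (J \<inter> A y) \<le> 1"
      using prJ fin by (subst card_le_Suc0_iff_eq[folded One_nat_def]) (auto simp: A_def inj_on_def)
    ultimately show ?thesis using T2 by linarith
  qed
  have "card (I \<union> J) \<le> card I + card J" by (rule card_Un_le)
  moreover have "\<exists>x\<in>B. card (A x) \<le> 1" using x by (metis card.empty zero_le)
  ultimately show False
    using chromatic_upper_spread less IJ(6) cardI cardJ by simp
qed

section \<open>The kinds of vertices of B, and what criticality says about them\<close>

definition lones :: "'a \<Rightarrow> 'a set" where "lones x = {v \<in> A x. lone v}"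
text \<open>(c1) and (c2) in one condition: without leaves every attached clique has at least two
  vertices, so three outer neighbours mean a clique with at least three vertices or two cliques with
  two.\<close>

definition big :: "'a \<Rightarrow> bool" where "big x \<longleftrightarrow> 3 \<le> card (A x) \<and> lones x = {}"
text \<open>Condition (c3), with the degree counted outside B.\<close>

definition twin :: "'a \<Rightarrow> bool" where "twin x \<longleftrightarrow> card (A x) = 2 \<and> 2 \<le> card (lones x)"

lemma A_iff: "v \<in> A x \<longleftrightarrow> v \<in> V - B \<and> pr v = x"
  by (simp add: A_def)

lemma same_class_A: "v \<in> A x \<Longrightarrow> u \<in> V - B \<Longrightarrow> cp u = cp v \<Longrightarrow> u \<in> A x"
  using same_class_pr[of u v] by (simp add: A_iff)

lemma not_lone: "v \<in> A x \<Longrightarrow> \<not> lone v \<Longrightarrow> \<exists>u\<in>A x. u \<noteq> v \<and> cp u = cp v"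
  using same_class_A unfolding lone_def by blast

lemma not_lone_T:
  assumes "x \<in> B" "v \<in> A x" "\<not> lone v" shows "x \<in> T"
proof -
  obtain u where "u \<in> A x" "u \<noteq> v" "cp u = cp v" using not_lone[OF assms(2,3)] by blast
  then show ?thesis using assms(1,2) unfolding T_iff by metis
qed

lemma lone_if_not_T: "x \<in> B \<Longrightarrow> x \<notin> T \<Longrightarrow> v \<in> A x \<Longrightarrow> lone v"
  using not_lone_T by blast

lemma twin_lones: "twin x \<Longrightarrow> lones x = A x"
  unfolding twin_def lones_def by (rule card_seteq) auto

lemma twin_not_T: "twin x \<Longrightarrow> x \<notin> T"
  using twin_lones[of x] cp_of_lone by (auto simp: T_iff lones_def A_iff)

lemma big_T: "x \<in> B \<Longrightarrow> big x \<Longrightarrow> x \<in> T"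
proof -
  assume *: "x \<in> B" "big x"
  then have "A x \<noteq> {}" unfolding big_def by auto
  then show "x \<in> T" using * not_lone_T unfolding big_def lones_def by blast
qed

text \<open>With \<open>T\<close> empty all outer vertices are leaves and (a) results. Otherwise
  every vertex of B has at least two outer neighbours, and a leaf forces exactly two, both leaves,
  since a second vertex of another kind would need a partner. A vertex that is neither
  \<open>big\<close> nor \<open>twin\<close> carries a single pendant triangle and must be all of
  \<open>T\<close>, which is (b).\<close>

lemma critical_cases:
  assumes crit: "packing_critical V E"
    and yz: "y \<in> B" "z \<in> B" "y \<noteq> z" "A y \<noteq> {}" "A z \<noteq> {}"
  shows "(\<forall>x\<in>B. card (A x) = 1)
    \<or> ((\<forall>x\<in>B. card (A x) = 2) \<and> card {x \<in> B. 2 \<le> card (lones x)} = card B - 1)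
    \<or> ((\<forall>x\<in>B. big x \<or> twin x) \<and> (\<exists>x\<in>B. big x))"
proof (cases "T = {}")
  case True
  then have lone: "lone v" if "v \<in> A x" "x \<in> B" for v x using lone_if_not_T that by blast
  have *: "(\<forall>x\<in>B. A x \<noteq> {}) \<and> card (A x) = 1" if "v \<in> A x" "x \<in> B" for v x
    using critical_lone[OF crit, of v] lone[OF that] that True by (auto simp: A_iff)
  then have "\<forall>x\<in>B. A x \<noteq> {}" using yz by blast
  then have "\<forall>x\<in>B. card (A x) = 1" using * by blast
  then show ?thesis by blast
next
  case False
  have K: "2 \<le> card (A x)" "lones x \<noteq> {} \<Longrightarrow> card (A x) = 2" if "x \<in> B" for x
  proof -
    have L: "(\<forall>x\<in>B. 2 \<le> card (A x)) \<and> card (A (pr l)) = 2" if "l \<in> V - B" "lone l" for l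
      using critical_lone[OF crit that] False by blast
    then show "card (A x) = 2" if "lones x \<noteq> {}" using that by (auto simp: lones_def A_iff)
    show "2 \<le> card (A x)"
    proof (cases "\<exists>l\<in>V - B. lone l")
      case True
      then show ?thesis using L \<open>x \<in> B\<close> by blast
    next
      case no: False
      \<comment> \<open>Without any leaf to delete, a bare vertex is excluded through an edge of B
        instead.\<close>
      then have "A x \<noteq> {}" using critical_bare[OF crit \<open>x \<in> B\<close> _ _ yz] by blast
      then obtain v where v: "v \<in> A x" by blast
      then obtain u where "u \<in> A x" "u \<noteq> v" using no not_lone[OF v] by (auto simp: A_iff)
      then show ?thesis using v card_mono[of "A x" "{u, v}"] by simp
    qed
  qed
  have lones_twin: "twin x" if x: "x \<in> B" "lones x \<noteq> {}" for x
  proof -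
    have 2: "card (A x) = 2" using K x by blast
    obtain l where l: "l \<in> A x" "lone l" using x(2) by (auto simp: lones_def)
    have "lone w" if w: "w \<in> A x" for w
    proof (rule ccontr)
      assume "\<not> lone w"
      then obtain u where u: "u \<in> A x" "u \<noteq> w" "cp u = cp w" using not_lone[OF w] by blast
      then have "l \<noteq> u" "l \<noteq> w" using l w unfolding lone_def A_iff by metis+
      then have "card {l, u, w} = 3" using u by simp
      then show False using card_mono[of "A x" "{l, u, w}"] l u w 2 by simp
    qed
    then have "lones x = A x" by (auto simp: lones_def)
    then show ?thesis using 2 by (simp add: twin_def)
  qed
  show ?thesis
  proof (cases "\<forall>x\<in>B. big x \<or> twin x")
    case True
    obtain x where "x \<in> T" using False by blast
    then have "x \<in> B" "\<not> twin x" using twin_not_T by (auto simp: T_iff)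
    then show ?thesis using True by blast
  next
    case F: False
    then obtain x where x: "x \<in> B" "\<not> big x" "\<not> twin x" by blast
    then have l0: "lones x = {}" using lones_twin by blast
    then have c2: "card (A x) = 2" using K(1)[OF x(1)] x(2) by (simp add: big_def)
    then obtain u v where uv: "A x = {u, v}" "u \<noteq> v" by (auto simp: card_2_iff)
    then have "\<not> lone u" "u \<in> A x" using l0 by (auto simp: lones_def)
    then have "cp u = cp v" using not_lone[of u x] uv by auto
    then have Tx: "T = {x}" using critical_triangle[OF crit K(1) x(1) uv] by blast
    have tw: "twin z" if "z \<in> B" "z \<noteq> x" for z
    proof -
      have "z \<notin> T" using Tx that by blast
      then have "lones z = A z" using lone_if_not_T that unfolding lones_def by blast
      moreover have "A z \<noteq> {}" using K(1)[OF that(1)] by auto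
      ultimately show ?thesis using lones_twin that by simp
    qed
    then have "\<forall>x\<in>B. card (A x) = 2" using c2 unfolding twin_def by blast
    moreover have "{z \<in> B. 2 \<le> card (lones z)} = B - {x}"
      using tw l0 unfolding twin_def by auto
    ultimately show ?thesis using x(1) by simp
  qed
qed

section \<open>Sufficient conditions\<close>

text \<open>\<open>m\<close> stands for the maximal size of the union before the deletion; a larger
  union afterwards saves a colour.\<close>

lemma chromatic_less_if_two_classes:
  assumes "card V + 2 \<le> packing_chromatic V E + m"
    and "I \<subseteq> V" "J \<subseteq> V" "I \<inter> J = {}" "spread E' 1 I" "spread E' 2 J" "m < card (I \<union> J)"
  shows "packing_chromatic V E' < packing_chromatic V E"
  using chromatic_le_two_classes[OF finV assms(2-6)] assms(1,7) by linarith

lemma spread_R_minus: "spread (E - F) 1 (R - X)"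
  using spread_subset[OF spread_mono[OF spread_R Diff_subset] Diff_subset] .

lemma edge_R: "v \<in> V - B \<Longrightarrow> r \<in> R \<Longrightarrow> cp v \<noteq> r \<Longrightarrow> {v, r} \<notin> E"
  using edge_AA[of v r] unfolding R_def by simp

lemma edge_other: "x \<in> B \<Longrightarrow> v \<in> V - B \<Longrightarrow> pr v \<noteq> x \<Longrightarrow> {x, v} \<notin> E"
  using edge_BA[of x v] by simp

lemma spread_spare:
  assumes "X \<subseteq> T" "J \<subseteq> V - B" "inj_on pr J" "pr ` J \<inter> X = {}"
  shows "spread (E - F) 2 (J \<union> spare ` X)"
proof -
  note s = spare_image[OF assms(1)]
  have "pr ` spare ` X = X" using spare assms(1) by force
  then have "inj_on pr (J \<union> spare ` X)" using s(2) assms(3,4)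
    by (subst inj_on_Un) blast
  then show ?thesis using s(1) assms(2) spread_mono[OF spread_2_if_inj, of "J \<union> spare ` X"] by blast
qed

lemma edge_cases:
  assumes "e \<in> E"
  obtains (inner) a b where "e = {a, b}" "a \<in> B" "b \<in> B" "a \<noteq> b"
    | (spoke) u where "e = {pr u, u}" "u \<in> V - B"
    | (outer) u v where "e = {u, v}" "u \<in> V - B" "v \<in> V - B" "u \<noteq> v" "cp u = cp v"
proof -
  obtain u v where e: "e = {u, v}" "u \<noteq> v" "u \<in> V" "v \<in> V"
    using gr assms by (auto simp: graph_def)
  consider "u \<in> B" "v \<in> B" | "u \<in> B" "v \<notin> B" | "u \<notin> B" "v \<in> B" | "u \<notin> B" "v \<notin> B" by blast
  then show ?thesis
  proof cases
    case 1
    then show ?thesis using inner e by blast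
  next
    case 2
    then have "pr v = u" using edge_BA[of u v] e assms by blast
    then show ?thesis using spoke[of v] e 2 by blast
  next
    case 3
    then have "pr u = v" using edge_AB[of u v] e assms by blast
    then show ?thesis using spoke[of u] e 3 by (auto simp: insert_commute)
  next
    case 4
    then have "cp u = cp v" using edge_AA[of u v] e assms by blast
    then show ?thesis using outer[of u v] e 4 by blast
  qed
qed

lemma edge_diff_rt:
  assumes "{u, v} \<in> E" "rt u \<noteq> rt v" shows "u \<in> B \<and> v \<in> B"
proof -
  have uv: "u \<in> V" "v \<in> V" using edge_in_V assms(1) by blast+
  show ?thesis
    using edge_BA[of u v] edge_AB[of u v] edge_AA[of u v] same_class_pr[of u v] assms uv
    by (cases "u \<in> B"; cases "v \<in> B") (auto simp: rt_def)
qed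

text \<open>The first and last of three steps from p to q stay at the roots a and b, so the middle
  step changes the root. Such an edge lies in B and could only be the deleted
  \<open>ab\<close>.\<close>

lemma far_after_deletion:
  assumes "a \<in> B" "b \<in> B" "a \<noteq> b" "p \<in> A a" "q \<in> A b"
  shows "enat 3 < dist (E - {{a, b}}) p q"
proof (rule ccontr)
  let ?E = "E - {{a, b}}"
  assume "\<not> ?thesis"
  then have "dist ?E p q \<le> enat 3" by simp
  then obtain w z where wz: "near ?E p w" "near ?E w z" "near ?E q z"
    unfolding dist_le_3 using near_sym by metis
  have rt: "rt w = x" if "near ?E v w" "v \<in> A x" "x \<in> B" for v w x
  proof -
    have v: "v \<in> V - B" "pr v = x" using that by (auto simp: A_iff)
    have "near E v w" using near_mono[OF that(1), of E] by blast
    then have "w = pr v \<or> w \<in> V - B \<and> cp w = cp v" using near_A v(1) by blast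
    then have "w = x \<or> w \<notin> B \<and> pr w = x" using v same_class_pr[of w v] by blast
    then show ?thesis using that(3) unfolding rt_def by auto
  qed
  have "rt w = a" "rt z = b" using rt[OF wz(1)] rt[OF wz(3)] assms by auto
  then have ne: "rt w \<noteq> rt z" using assms by simp
  then have "{w, z} \<in> ?E" using wz(2) by (auto simp: near_def)
  moreover from this have "w \<in> B" "z \<in> B" using edge_diff_rt ne by blast+
  then have "w = a" "z = b" using \<open>rt w = a\<close> \<open>rt z = b\<close> by (auto simp: rt_def)
  ultimately show False by blast
qed

text \<open>Before the deletion the union has at most \<open>card R + 1\<close> vertices. Without
  \<open>ab\<close>, both a and b take colour 1 and their leaves colour 2. Without a spoke, its end
  in B joins all leaves in colour 1, and another vertex of B takes colour 2.\<close>

lemma corona_critical: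
  assumes one: "\<And>x. x \<in> B \<Longrightarrow> card (A x) = 1" and e: "e \<in> E"
  shows "packing_chromatic V (E - {e}) < packing_chromatic V E"
proof -
  have uniq: "u = v" if "u \<in> V - B" "v \<in> V - B" "pr u = pr v" for u v
  proof -
    have "u \<in> A (pr u)" "v \<in> A (pr u)" "card (A (pr u)) = 1"
      using that one pr_in by (auto simp: A_iff)
    then show ?thesis by (metis card_1_singletonE singletonD)
  qed
  have cpv: "cp v = v" if "v \<in> V - B" for v
    using uniq[of "cp v" v] cp_in pr_cp that by blast
  have RV: "R = V - B" using cpv by (auto simp: R_def)
  have T0: "T = {}" using cpv by (auto simp: T_iff A_iff)
  have ne: "\<not> (\<exists>x\<in>B. A x = {})" using one by fastforce
  have low: "card V + 2 \<le> packing_chromatic V E + (card R + 1)"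
    using chromatic_lower
  proof
    assume "card V + 2 \<le> packing_chromatic V E + card R + card T + of_bool (\<exists>x\<in>B. card (A x) \<le> 1)"
    moreover have "of_bool (\<exists>x\<in>B. card (A x) \<le> 1) \<le> (1 :: nat)" by simp
    ultimately show ?thesis unfolding T0 card.empty by linarith
  qed (simp only: ne of_bool_eq)
  from e show ?thesis
  proof (cases rule: edge_cases)
    case (inner a b)
    let ?I = "insert a (insert b (R - (A a \<union> A b)))" and ?J = "A a \<union> A b"
    have "spread (E - {e}) 1 (insert b (R - (A a \<union> A b)))"
      by (rule spread_1_insert[OF spread_R_minus])
        (use inner edge_other[of b] in \<open>auto simp: RV A_iff\<close>)
    then have "spread (E - {e}) 1 ?I"
      by (rule spread_1_insert) (use inner edge_other[of a] in \<open>auto simp: RV A_iff\<close>)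
    moreover have JV: "?J \<subseteq> V - B" by (auto simp: A_iff)
    then have "inj_on pr ?J" using uniq by (meson inj_onI subsetD)
    then have "spread (E - {e}) 2 ?J"
      using spread_mono[OF spread_2_if_inj[OF JV]] by blast
    moreover have "?I \<union> ?J = insert a (insert b R)" using JV RV by blast
    then have "card (?I \<union> ?J) = card R + 2" using inner RV by simp
    moreover have "?I \<subseteq> V" "?J \<subseteq> V" "?I \<inter> ?J = {}" using inner BV RV JV by auto
    ultimately show ?thesis using chromatic_less_if_two_classes[OF low, of ?I ?J] by simp
  next
    case (spoke u)
    have x: "pr u \<in> B" using pr_in spoke by blast
    obtain b where b: "b \<in> B" "b \<noteq> pr u" using two_in_B by metis
    let ?I = "insert (pr u) R"
    have "spread (E - {e}) 1 R" using spread_R_minus[of "{e}" "{}"] by simp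
    then have "spread (E - {e}) 1 ?I"
      by (rule spread_1_insert)
        (use spoke uniq edge_other[OF x] RV in blast)
    moreover have "?I \<subseteq> V" "{b} \<subseteq> V" "?I \<inter> {b} = {}" using x b BV RV by auto
    moreover have "spread (E - {e}) 2 {b}" by (simp add: spread_def)
    moreover have "card (?I \<union> {b}) = card R + 2" using x b RV by simp
    ultimately show ?thesis using chromatic_less_if_two_classes[OF low, of ?I "{b}"] by simp
  next
    case (outer u v)
    then show ?thesis using uniq same_class_pr by blast
  qed
qed

section \<open>Single-edge deletions in cases (b) and (c)\<close>

definition tri :: "'a \<Rightarrow> bool" where "tri x \<longleftrightarrow> T = {x} \<and> card (A x) = 2 \<and> lones x = {}"

lemma nonrep_in_class:
  assumes "v \<in> A x" "\<not> lone v"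
  shows "\<exists>w\<in>A x. cp w = cp v \<and> w \<notin> R"
proof -
  obtain u where u: "u \<in> A x" "u \<noteq> v" "cp u = cp v" using not_lone[OF assms] by blast
  show ?thesis
  proof (cases "v \<in> R")
    case True
    then have "cp u \<noteq> u" using u by (simp add: R_def)
    then show ?thesis using u by (intro bexI[of _ u]) (auto simp: R_def)
  next
    case False
    then show ?thesis using assms(1) by blast
  qed
qed

text \<open>Every attached clique at x has a vertex outside \<open>R\<close>. If
  \<open>spare x\<close> were the only such vertex, it and its representative would be all outer
  neighbours, too few for \<open>big x\<close>.\<close>

lemma big_two_nonreps:
  assumes "x \<in> B" "big x"
  shows "\<exists>q\<in>A x. q \<notin> R \<and> q \<noteq> spare x"
proof (rule ccontr)
  assume no: "\<not> ?thesis"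
  have "v \<in> {spare x, cp (spare x)}" if v: "v \<in> A x" for v
  proof (cases "v \<in> R")
    case True
    have "\<not> lone v" using v assms(2) by (auto simp: big_def lones_def)
    then obtain w where "w \<in> A x" "cp w = cp v" "w \<notin> R" using nonrep_in_class[OF v] by blast
    then have "cp (spare x) = cp v" using no by metis
    then show ?thesis using True by (simp add: R_def)
  next
    case False
    then show ?thesis using no v by blast
  qed
  then have "A x \<subseteq> {spare x, cp (spare x)}" by blast
  then have "card (A x) \<le> card {spare x, cp (spare x)}" by (intro card_mono) auto
  also have "\<dots> \<le> 2" by (simp add: card_insert_if)
  finally show False using assms(2) by (simp add: big_def)
qed

lemma chromatic_less_local:
  assumes low: "card V + 2 \<le> packing_chromatic V E + (card R + card T)"
    and I: "I \<subseteq> V" "\<And>i. i \<in> I \<Longrightarrow> i \<in> B \<or> i \<in> R \<or> pr i = x" "spread E' 1 I"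
    and J: "J \<subseteq> A x" "I \<inter> J = {}" "spread E' 2 (J \<union> spare ` (T - {x}))"
    and more: "card R + card T < card I + card J + card (T - {x})"
  shows "packing_chromatic V E' < packing_chromatic V E"
proof -
  let ?S = "spare ` (T - {x})"
  note s = spare_image[of "T - {x}", OF Diff_subset]
  have prS: "pr j \<noteq> x" if "j \<in> ?S" for j using that spare by auto
  have fin: "finite I" "finite J" "finite ?S"
    using I(1) J(1) by (auto intro: finite_subset[OF _ finV] finite_subset[OF _ finA])
  have JS: "J \<inter> ?S = {}" using prS J(1) unfolding A_def by blast
  have IS: "I \<inter> ?S = {}" using prS I(2) s(1) by blast
  have "card (I \<union> (J \<union> ?S)) = card I + card J + card (T - {x})"
    using fin JS IS J(2) s(3) by (subst card_Un_disjoint, simp, simp, blast) (simp add: card_Un_disjoint)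
  moreover have "J \<union> ?S \<subseteq> V" using J(1) s(1) unfolding A_def by blast
  moreover have "I \<inter> (J \<union> ?S) = {}" using J(2) IS by blast
  ultimately show ?thesis
    using chromatic_less_if_two_classes[OF low I(1) _ _ I(3) J(3)] more by simp
qed

lemma card_T_minus: "x \<in> T \<Longrightarrow> card (T - {x}) + 1 = card T"
  using card_Suc_Diff1[OF finT] by simp

lemma card_R_minus: "r \<in> R \<Longrightarrow> card (R - {r}) + 1 = card R"
  using card_Suc_Diff1[OF finR] by simp

lemma spread_J_single: "j \<in> A x \<Longrightarrow> spread (E - F) 2 ({j} \<union> spare ` (T - {x}))"
  by (rule spread_spare) (auto simp: A_iff)

text \<open>x takes colour 1 in place of its other leaf w, which moves to colour 2, while u, now cut
  off, keeps colour 1. One vertex is gained because x is not in \<open>T\<close> and had no colour-2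
  vertex.\<close>

lemma spoke_twin:
  assumes low: "card V + 2 \<le> packing_chromatic V E + (card R + card T)"
    and x: "x \<in> B" "twin x" and u: "u \<in> A x"
  shows "packing_chromatic V (E - {{x, u}}) < packing_chromatic V E"
proof -
  obtain w where w: "A x = {u, w}" "u \<noteq> w"
    using x(2) u by (auto simp: twin_def card_2_iff doubleton_eq_iff)
  have wA: "w \<in> A x" using w by blast
  have "lone w" using twin_lones[OF x(2)] wA by (auto simp: lones_def)
  then have wR: "w \<in> R" using cp_of_lone wA by (auto simp: A_iff R_def)
  have xR: "x \<notin> R" using x(1) R_sub by blast
  have xT: "T - {x} = T" using twin_not_T[OF x(2)] by blast
  have "spread (E - {{x, u}}) 1 (insert x (R - {w}))"
  proof (rule spread_1_insert[OF spread_R_minus])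
    fix v assume v: "v \<in> R - {w}"
    show "{x, v} \<notin> E - {{x, u}}"
    proof (cases "v = u")
      case False
      then have "v \<notin> A x" using v w by blast
      then show ?thesis using edge_other[OF x(1), of v] v R_sub unfolding A_def by blast
    qed blast
  qed
  moreover have "insert x (R - {w}) \<subseteq> V" using x(1) BV R_sub by blast
  moreover have "insert x (R - {w}) \<inter> {w} = {}" using x(1) wA by (auto simp: A_iff)
  moreover have "card (insert x (R - {w})) = card R" using xR card_R_minus[OF wR] by simp
  ultimately show ?thesis
    using wA x(1) spread_J_single[OF wA, of "{{x, u}}"]
    by (intro chromatic_less_local[OF low, of "insert x (R - {w})" x _ "{w}"]) (auto simp: xT)
qed

lemma spread_I_swap:
  assumes "v \<in> V - B"
  shows "spread (E - F) 1 (insert v (R - {cp v}))"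
  by (rule spread_1_insert[OF spread_R_minus]) (use edge_R[OF assms] in blast)

text \<open>If x carries a second clique, the cut puts u beyond distance 2 from a vertex w of it, so
  u and w both take colour 2 and a clique mate v of u takes colour 1. If there is only one clique, x
  joins colour 1 with u as the colour-1 vertex of the clique, and v takes colour 2.\<close>

lemma spoke_class:
  assumes low: "card V + 2 \<le> packing_chromatic V E + (card R + card T)"
    and x: "x \<in> B" "lones x = {}" and u: "u \<in> A x"
  shows "packing_chromatic V (E - {{x, u}}) < packing_chromatic V E"
proof -
  let ?E = "E - {{x, u}}"
  have nl: "\<not> lone v" if "v \<in> A x" for v using x(2) that by (auto simp: lones_def)
  have xT: "x \<in> T" using not_lone_T[OF x(1) u nl[OF u]] .
  obtain v where v: "v \<in> A x" "v \<noteq> u" "cp v = cp u" using not_lone[OF u nl[OF u]] by blast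
  have uV: "u \<in> V - B" "pr u = x" and vV: "v \<in> V - B" "pr v = x" using u v by (auto simp: A_iff)
  have cR: "cp u \<in> R" using A_nonempty_R[OF u] by blast
  have rep: "r = cp r" if "r \<in> R" for r using that by (simp add: R_def)
  show ?thesis
  proof (cases "\<exists>w\<in>A x. cp w \<noteq> cp u")
    case True
    then obtain w where w: "w \<in> A x" "cp w \<noteq> cp u" "w \<notin> R"
      using nonrep_in_class nl by metis
    have wV: "w \<in> V - B" "pr w = x" using w by (auto simp: A_iff)
    let ?I = "insert v (R - {cp u})"
    have sI: "spread ?E 1 ?I" using spread_I_swap[OF vV(1)] v(3) by simp
    have far: "\<not> (near ?E u t \<and> near ?E w t)" for t
    proof
      assume t: "near ?E u t \<and> near ?E w t"
      have "t \<noteq> x" using t uV x(1) by (auto simp: near_def insert_commute)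
      then have "cp t = cp u" "cp t = cp w"
        using near_A[OF near_mono[of ?E u t E] uV(1)] near_A[OF near_mono[of ?E w t E] wV(1)] t uV wV
        by auto
      then show False using w(2) by simp
    qed
    have 1: "spread ?E 2 ({u} \<union> spare ` (T - {x}))" "spread ?E 2 ({w} \<union> spare ` (T - {x}))"
      using spread_J_single u w(1) by blast+
    have "spread ?E 2 ({u, w} \<union> spare ` (T - {x}))"
      unfolding spread_2_iff
    proof (intro ballI impI)
      fix a b assume ab: "a \<in> {u, w} \<union> spare ` (T - {x})" "b \<in> {u, w} \<union> spare ` (T - {x})" "a \<noteq> b"
      show "\<nexists>t. near ?E a t \<and> near ?E t b"
      proof (cases "{a, b} = {u, w}")
        case True
        then show ?thesis using far near_sym[of ?E] by (metis doubleton_eq_iff)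
      next
        case False
        then have "a \<in> {u} \<union> spare ` (T - {x}) \<and> b \<in> {u} \<union> spare ` (T - {x})
          \<or> a \<in> {w} \<union> spare ` (T - {x}) \<and> b \<in> {w} \<union> spare ` (T - {x})" using ab by auto
        then show ?thesis using 1 ab(3) unfolding spread_2_iff by meson
      qed
    qed
    moreover have "v \<notin> R - {cp u}" using rep v(3) by force
    then have "card ?I = card R" using card_R_minus[OF cR] by simp
    moreover have uw: "u \<noteq> w" using w by blast
    moreover have "?I \<inter> {u, w} = {}" using v w rep[of u] by auto
    moreover have "?I \<subseteq> V" using vV R_sub by blast
    moreover have "card {u, w} = 2" using uw by simp
    ultimately show ?thesis
      using u w(1) vV sI card_T_minus[OF xT]
      by (intro chromatic_less_local[OF low, of ?I x ?E "{u, w}"]) auto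
  next
    case False
    let ?I = "insert x (insert u (R - {cp u}))"
    have "spread ?E 1 (insert u (R - {cp u}))" using spread_I_swap[OF uV(1)] .
    then have "spread ?E 1 ?I"
    proof (rule spread_1_insert)
      fix r assume r: "r \<in> insert u (R - {cp u})"
      show "{x, r} \<notin> ?E"
      proof (cases "r = u")
        case f: False
        then have "r \<in> R" "r \<noteq> cp u" using r by auto
        then have "r \<notin> A x" using False rep by metis
        then show ?thesis using \<open>r \<in> R\<close> edge_other[OF x(1), of r] R_sub unfolding A_def by blast
      qed blast
    qed
    moreover have "u \<notin> R - {cp u}" using rep by force
    then have "card (insert u (R - {cp u})) = card R" using card_R_minus[OF cR] by simp
    moreover have "x \<notin> insert u (R - {cp u})" using x(1) uV(1) R_sub by blast
    ultimately have "spread ?E 1 ?I" "card ?I = card R + 1" by simp_all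
    moreover have "v \<notin> R - {cp u}" using rep v(3) by force
    then have "?I \<inter> {v} = {}" using v x(1) vV by auto
    moreover have "?I \<subseteq> V" using x(1) BV uV R_sub by blast
    ultimately show ?thesis
      using v(1) x(1) uV card_T_minus[OF xT] spread_J_single[OF v(1), of "{{x, u}}"]
      by (intro chromatic_less_local[OF low, of ?I x ?E "{v}"]) auto
  qed
qed

text \<open>Both u and v take colour 1, a gain of one if a colour-2 vertex remains available. For
  \<open>big x\<close> another outer neighbour serves; for \<open>tri x\<close> the vertex x itself
  takes colour 2, at no loss since it is the only element of \<open>T\<close>.\<close>

lemma outer_class:
  assumes low: "card V + 2 \<le> packing_chromatic V E + (card R + card T)"
    and x: "x \<in> B" "big x \<or> tri x"
    and uv: "u \<in> A x" "v \<in> A x" "u \<noteq> v" "cp u = cp v"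
  shows "packing_chromatic V (E - {{u, v}}) < packing_chromatic V E"
proof -
  let ?E = "E - {{u, v}}"
  let ?I = "insert u (insert v (R - {cp u}))"
  have nl: "\<not> lone w" if "w \<in> A x" for w using x(2) that by (auto simp: lones_def big_def tri_def)
  have xT: "x \<in> T" using not_lone_T[OF x(1) uv(1) nl[OF uv(1)]] .
  have uV: "u \<in> V - B" "pr u = x" and vV: "v \<in> V - B" "pr v = x" using uv by (auto simp: A_iff)
  have cR: "cp u \<in> R" using A_nonempty_R[OF uv(1)] by blast
  have rep: "r = cp r" if "r \<in> R" for r using that by (simp add: R_def)
  have "spread ?E 1 (insert v (R - {cp u}))" using spread_I_swap[OF vV(1)] uv(4) by simp
  then have sI: "spread ?E 1 ?I"
    by (rule spread_1_insert) (use edge_R[OF uV(1)] in blast)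
  have "u \<notin> R - {cp u}" "v \<notin> R - {cp u}" using rep uv(4) by force+
  then have cI: "card ?I = card R + 1" using uv(3) card_R_minus[OF cR] by simp
  have IV: "?I \<subseteq> V" using uV vV R_sub by blast
  from x(2) show ?thesis
  proof
    assume big: "big x"
    \<comment> \<open>A clique other than that of u has a vertex outside \<open>R\<close>; a third
      vertex of the clique of u is free as well, since its representative was taken out of
      \<open>R\<close>.\<close>
    have "\<exists>w\<in>A x. w \<notin> ?I"
    proof (rule ccontr)
      assume no: "\<not> ?thesis"
      have "w \<in> {u, v}" if w: "w \<in> A x" for w
      proof (cases "cp w = cp u")
        case True
        then show ?thesis using no w rep by force
      next
        case False
        obtain w' where "w' \<in> A x" "cp w' = cp w" "w' \<notin> R" using nonrep_in_class[OF w nl[OF w]] by blast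
        then show ?thesis using no False uv(4) by auto
      qed
      then have "card (A x) \<le> card {u, v}" by (intro card_mono) auto
      then show False using big uv(3) by (simp add: big_def)
    qed
    then obtain w where w: "w \<in> A x" "w \<notin> ?I" by blast
    then show ?thesis
      using sI cI IV uV vV card_T_minus[OF xT] spread_J_single[OF w(1), of "{{u, v}}"]
      by (intro chromatic_less_local[OF low, of ?I x ?E "{w}"]) auto
  next
    assume "tri x"
    then have "card T = 1" by (simp add: tri_def)
    moreover have "x \<notin> ?I" using x(1) uV vV R_sub by blast
    then have "?I \<inter> {x} = {}" "card (?I \<union> {x}) = card R + 2" using cI by auto
    moreover have "spread ?E 2 {x}" by (simp add: spread_def)
    ultimately show ?thesis
      using chromatic_less_if_two_classes[OF low IV, of "{x}"] sI x(1) BV by auto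
  qed
qed

text \<open>After deleting an edge \<open>ab\<close> of B, one colour-3 pair becomes available, so it suffices to
  leave free one vertex attached to a and one attached to b without losing colours 1 and 2.\<close>
lemma local_package:
  assumes "x \<in> B" "big x \<or> card (A x) = 2 \<and> (twin x \<or> tri x)"
  obtains I u q where "I \<subseteq> insert x (A x)" "u \<in> A x" "q \<in> A x" "u \<noteq> q" "u \<notin> I" "q \<notin> I"
    "spread E 1 I" "card I + 1 = card {r \<in> R. pr r = x} + card (T \<inter> {x})"
proof (cases "big x")
  case True
  let ?I = "{r \<in> R. pr r = x}"
  have xT: "x \<in> T" using big_T[OF assms(1) True] .
  obtain q where "q \<in> A x" "q \<notin> R" "q \<noteq> spare x" using big_two_nonreps[OF assms(1) True] by blast
  moreover have "spare x \<in> A x" "spare x \<notin> R" using spare[OF xT] by (auto simp: A_iff R_def)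
  moreover have "?I \<subseteq> insert x (A x)" using R_sub unfolding A_def by blast
  moreover have "spread E 1 ?I" using spread_subset[OF spread_R, of ?I] by blast
  moreover have "card ?I + 1 = card ?I + card (T \<inter> {x})" using xT by simp
  ultimately show ?thesis using that[of ?I "spare x" q] by blast
next
  case False
  then have c: "card (A x) = 2" "twin x \<or> tri x" using assms(2) by auto
  then obtain u q where uq: "A x = {u, q}" "u \<noteq> q" by (auto simp: card_2_iff)
  then have V: "u \<in> A x" "q \<in> A x" by auto
  \<comment> \<open>The allowance at x is 2 either way: two representatives for \<open>twin\<close>,
    one representative and membership in \<open>T\<close> for \<open>tri\<close>. So
    \<open>{x}\<close> can serve as I and both outer neighbours remain.\<close>
  have "card {r \<in> R. pr r = x} + card (T \<inter> {x}) = 2"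
    using c(2)
  proof
    assume tw: "twin x"
    then have "lone v" if "v \<in> A x" for v using twin_lones that by (auto simp: lones_def)
    then have "cp v = v" if "v \<in> A x" for v using that cp_of_lone by (auto simp: A_iff)
    then have "{r \<in> R. pr r = x} = A x" unfolding R_def A_def by blast
    then show ?thesis using c(1) twin_not_T[OF tw] by simp
  next
    assume tr: "tri x"
    then have "\<not> lone u" using V by (auto simp: tri_def lones_def)
    then obtain w where "w \<in> A x" "w \<noteq> u" "cp w = cp u" using not_lone[OF V(1)] by blast
    then have cp: "cp q = cp u" using uq by auto
    have "{r \<in> R. pr r = x} = {cp u}"
    proof
      show "{r \<in> R. pr r = x} \<subseteq> {cp u}"
      proof
        fix r assume "r \<in> {r \<in> R. pr r = x}"
        then have "r \<in> A x" "cp r = r" by (auto simp: R_def A_iff)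
        then show "r \<in> {cp u}" using uq cp by auto
      qed
      show "{cp u} \<subseteq> {r \<in> R. pr r = x}" using A_nonempty_R[OF V(1)] by blast
    qed
    then show ?thesis using tr by (simp add: tri_def)
  qed
  then have "card {x} + 1 = card {r \<in> R. pr r = x} + card (T \<inter> {x})" by simp
  moreover have "spread E 1 {x}" by (simp add: spread_def)
  moreover have "u \<noteq> x" "q \<noteq> x" using V assms(1) by (auto simp: A_iff)
  ultimately show ?thesis using that[of "{x}" u q] V uq(2) by blast
qed

text \<open>At each of a and b one vertex moves into J for the one that I gives up, so colours 1 and
  2 still cover \<open>card R + card T\<close> vertices, and colour 3 on \<open>qa\<close>,
  \<open>qb\<close> is the gain. I may contain both a and b, which are no longer adjacent.\<close>

lemma inner_edge:
  assumes low: "card V + 2 \<le> packing_chromatic V E + (card R + card T)"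
    and ab: "a \<in> B" "b \<in> B" "a \<noteq> b"
    and ga: "big a \<or> card (A a) = 2 \<and> (twin a \<or> tri a)"
    and gb: "big b \<or> card (A b) = 2 \<and> (twin b \<or> tri b)"
  shows "packing_chromatic V (E - {{a, b}}) < packing_chromatic V E"
proof -
  let ?E = "E - {{a, b}}"
  obtain Ia ua qa where pa: "Ia \<subseteq> insert a (A a)" "ua \<in> A a" "qa \<in> A a" "ua \<noteq> qa" "ua \<notin> Ia" "qa \<notin> Ia"
    "spread E 1 Ia" "card Ia + 1 = card {r \<in> R. pr r = a} + card (T \<inter> {a})"
    using local_package[OF ab(1) ga] .
  obtain Ib ub qb where pb: "Ib \<subseteq> insert b (A b)" "ub \<in> A b" "qb \<in> A b" "ub \<noteq> qb" "ub \<notin> Ib" "qb \<notin> Ib"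
    "spread E 1 Ib" "card Ib + 1 = card {r \<in> R. pr r = b} + card (T \<inter> {b})"
    using local_package[OF ab(2) gb] .
  define R' where "R' = {r \<in> R. pr r \<notin> {a, b}}"
  define S where "S = spare ` (T - {a, b})"
  let ?I = "R' \<union> Ia \<union> Ib" and ?J = "{ua, ub} \<union> S"
  have rtA: "rt v = x" if "v \<in> insert x (A x)" "x \<in> B" for v x
    using that by (auto simp: rt_def A_iff)
  have rtR: "rt v \<notin> {a, b}" "v \<notin> B" if "v \<in> R'" for v
    using that R_sub unfolding R'_def rt_def by auto
  have rtIa: "rt v = a" if "v \<in> Ia" for v using rtA pa(1) ab(1) that by blast
  have rtIb: "rt v = b" if "v \<in> Ib" for v using rtA pb(1) ab(2) that by blast
  have s: "S \<subseteq> V - B - R" "card S = card (T - {a, b})"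
    using spare_image[of "T - {a, b}"] unfolding S_def by blast+
  have rtS: "rt v \<notin> {a, b}" if "v \<in> S" for v using that spare unfolding S_def rt_def by fastforce
  have sI: "spread ?E 1 ?I"
    unfolding spread_1_iff
  proof (intro ballI impI notI)
    fix u v assume uv: "u \<in> ?I" "v \<in> ?I" "u \<noteq> v" "{u, v} \<in> ?E"
    show False
    proof (cases "rt u = rt v")
      case True
      then have "u \<in> R' \<and> v \<in> R' \<or> u \<in> Ia \<and> v \<in> Ia \<or> u \<in> Ib \<and> v \<in> Ib"
        using uv rtR rtIa rtIb ab(3) by (metis UnE insert_iff)
      moreover have "spread E 1 R'" using spread_subset[OF spread_R, of R'] unfolding R'_def by blast
      ultimately show False using pa(7) pb(7) uv unfolding spread_1_iff by blast
    next
      case False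
      then have B: "u \<in> B" "v \<in> B" using edge_diff_rt uv by blast+
      then have "u \<in> {a, b}" "v \<in> {a, b}"
        using uv rtR(2) rtIa rtIb unfolding rt_def by (metis UnE insert_iff)+
      then show False using uv by auto
    qed
  qed
  have "inj_on pr {ua, ub}" "{ua, ub} \<subseteq> V - B" "pr ` {ua, ub} \<inter> (T - {a, b}) = {}"
    using pa(2) pb(2) ab(3) by (auto simp: A_iff)
  then have sJ: "spread ?E 2 ?J" unfolding S_def by (intro spread_spare) auto
  have rtu: "rt ua = a" "rt ub = b" "rt qa = a" "rt qb = b" using rtA pa pb ab by auto
  have ne: "ua \<notin> Ib" "ub \<notin> Ia" "ua \<notin> R'" "ub \<notin> R'" "ua \<noteq> ub" "ua \<notin> S" "ub \<notin> S"
    "qa \<notin> Ib" "qb \<notin> Ia" "qa \<notin> R'" "qb \<notin> R'" "qa \<noteq> qb" "qa \<notin> S" "qb \<notin> S" "ua \<noteq> qb" "ub \<noteq> qa"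
    using rtu rtR(1) rtIa rtIb rtS ab(3) by (metis insert_iff)+
  have IV: "?I \<subseteq> V" using pa(1) pb(1) ab BV R_sub unfolding R'_def A_def by blast
  have JV: "?J \<subseteq> V" using pa(2) pb(2) s(1) unfolding A_def by blast
  have "R' \<inter> S = {}" using s(1) unfolding R'_def by blast
  moreover have "Ia \<inter> S = {}" "Ib \<inter> S = {}" using rtS rtIa rtIb by blast+
  ultimately have "?I \<inter> S = {}" by blast
  then have IJ: "?I \<inter> ?J = {}" using ne pa(5) pb(5) by blast
  have fin: "finite R'" "finite Ia" "finite Ib" "finite S"
    using IV JV finite_subset[OF _ finV] by blast+
  have "R' \<inter> Ia = {}" "(R' \<union> Ia) \<inter> Ib = {}"
    using rtR(1) rtIa rtIb ab(3) by blast+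
  then have cI: "card ?I = card R' + card Ia + card Ib" using fin by (simp add: card_Un_disjoint)
  have cJ: "card ?J = 2 + card S" using fin ne by simp
  have "R = R' \<union> ({r \<in> R. pr r = a} \<union> {r \<in> R. pr r = b})" unfolding R'_def by blast
  moreover have "card (R' \<union> ({r \<in> R. pr r = a} \<union> {r \<in> R. pr r = b})) =
      card R' + (card {r \<in> R. pr r = a} + card {r \<in> R. pr r = b})"
    using ab(3) fin(1) by (auto simp: card_Un_disjoint R'_def disjoint_iff)
  ultimately have cR: "card R = card R' + (card {r \<in> R. pr r = a} + card {r \<in> R. pr r = b})" by simp
  have "T = (T - {a, b}) \<union> ((T \<inter> {a}) \<union> (T \<inter> {b}))" by blast
  moreover have "card ((T - {a, b}) \<union> ((T \<inter> {a}) \<union> (T \<inter> {b}))) =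
      card (T - {a, b}) + (card (T \<inter> {a}) + card (T \<inter> {b}))"
    using ab(3) by (subst card_Un_disjoint, simp, simp, blast) (subst card_Un_disjoint, auto)
  ultimately have cT: "card T = card (T - {a, b}) + (card (T \<inter> {a}) + card (T \<inter> {b}))" by simp
  have "card (?I \<union> ?J) = card R + card T"
    using card_Un_disjoint[OF _ _ IJ] fin cI cJ cR cT s(2) pa(8) pb(8) by simp
  moreover have "packing_chromatic V ?E + card (?I \<union> ?J) \<le> card V + 1"
  proof (rule chromatic_le_three_classes[OF finV IV JV IJ sI sJ, of qa qb])
    show "qa \<in> V - ?I - ?J" "qb \<in> V - ?I - ?J"
      using ne pa pb by (auto simp: A_iff)
    show "enat 3 < dist ?E qa qb" using far_after_deletion ab pa(3) pb(3) by blast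
    show "enat 3 < dist ?E qb qa"
      using far_after_deletion[of b a qb qa] ab pa(3) pb(3) by (simp add: insert_commute)
  qed (use ne in blast)
  ultimately show ?thesis using low by linarith
qed

text \<open>Treats (b) and (c) together. All vertices of B have at least two outer neighbours, so
  both bonus terms vanish, and \<open>T \<noteq> {}\<close> makes the choice with J inside B no
  better than \<open>card R + card T\<close>.\<close>

lemma mixed_critical:
  assumes good: "\<And>x. x \<in> B \<Longrightarrow> big x \<or> twin x \<or> tri x" and T: "T \<noteq> {}" and e: "e \<in> E"
  shows "packing_chromatic V (E - {e}) < packing_chromatic V E"
proof -
  have thick: "2 \<le> card (A x)" if "x \<in> B" for x
    using good[OF that] by (auto simp: big_def twin_def tri_def)
  have no: "\<not> (\<exists>x\<in>B. card (A x) \<le> 1)" "\<not> (\<exists>x\<in>B. A x = {})"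
    by (auto dest!: thick)
  have T1: "1 \<le> card T" using T by (simp add: Suc_le_eq card_gt_0_iff)
  have low: "card V + 2 \<le> packing_chromatic V E + (card R + card T)"
    using chromatic_lower unfolding eq_False[THEN iffD2, OF no(1)] eq_False[THEN iffD2, OF no(2)]
    using T1 by auto
  from e show ?thesis
  proof (cases rule: edge_cases)
    case (inner a b)
    have "big x \<or> card (A x) = 2 \<and> (twin x \<or> tri x)" if "x \<in> B" for x
      using good[OF that] by (auto simp: twin_def tri_def)
    then show ?thesis using inner_edge[OF low] inner by simp
  next
    case (spoke u)
    have u: "pr u \<in> B" "u \<in> A (pr u)" using spoke pr_in by (auto simp: A_iff)
    show ?thesis
    proof (cases "twin (pr u)")
      case True
      then show ?thesis using spoke_twin[OF low u(1) _ u(2)] spoke by simp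
    next
      case False
      then have "lones (pr u) = {}" using good[OF u(1)] by (auto simp: big_def tri_def)
      then show ?thesis using spoke_class[OF low u(1) _ u(2)] spoke by simp
    qed
  next
    case (outer u v)
    have x: "pr u \<in> B" "u \<in> A (pr u)" "v \<in> A (pr u)"
      using outer pr_in same_class_pr[of u v] by (auto simp: A_iff)
    have "\<not> lone u" using outer unfolding lone_def by metis
    then have "\<not> twin (pr u)" using twin_lones[of "pr u"] x(2) by (auto simp: lones_def)
    then have "big (pr u) \<or> tri (pr u)" using good[OF x(1)] by blast
    then show ?thesis using outer_class[OF low x(1) _ x(2,3)] outer by simp
  qed
qed

lemma edges_critical_if:
  assumes "(\<forall>x\<in>B. card (A x) = 1)
    \<or> ((\<forall>x\<in>B. card (A x) = 2) \<and> card {x \<in> B. 2 \<le> card (lones x)} = card B - 1)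
    \<or> ((\<forall>x\<in>B. big x \<or> twin x) \<and> (\<exists>x\<in>B. big x))" and e: "e \<in> E"
  shows "packing_chromatic V (E - {e}) < packing_chromatic V E"
  using assms(1)
proof (elim disjE)
  assume "\<forall>x\<in>B. card (A x) = 1"
  then show ?thesis using corona_critical e by blast
next
  assume b: "(\<forall>x\<in>B. card (A x) = 2) \<and> card {x \<in> B. 2 \<le> card (lones x)} = card B - 1"
  let ?L = "{x \<in> B. 2 \<le> card (lones x)}"
  \<comment> \<open>As \<open>card B\<close> is at least 2, the subtraction in (b) is not truncated
    and exactly one vertex is exceptional.\<close>
  have "card (B - ?L) = 1" using b card_B by (subst card_Diff_subset) auto
  then obtain x where x: "B - ?L = {x}" by (auto simp: card_1_singleton_iff)
  have tw: "twin z" if "z \<in> B" "z \<noteq> x" for z using b x that unfolding twin_def by blast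
  have xB: "x \<in> B" "\<not> 2 \<le> card (lones x)" using x by blast+
  obtain u v where uv: "A x = {u, v}" "u \<noteq> v" using b xB(1) by (meson card_2_iff)
  \<comment> \<open>Exactly one leaf among two outer neighbours is impossible: the other one would
    have no partner in its clique.\<close>
  have "lones x = {}"
  proof (rule ccontr)
    assume "lones x \<noteq> {}"
    then obtain l where l: "l \<in> A x" "lone l" by (auto simp: lones_def)
    have "lone w" if w: "w \<in> A x" for w
    proof (rule ccontr)
      assume nl: "\<not> lone w"
      then obtain w' where "w' \<in> A x" "w' \<noteq> w" "cp w' = cp w" using not_lone[OF w] by blast
      moreover have "l \<noteq> w" using l nl by blast
      ultimately have "w' = l" using uv l(1) w by auto
      then show False using l(2) \<open>cp w' = cp w\<close> \<open>l \<noteq> w\<close> w unfolding lone_def A_iff by metis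
    qed
    then have "lones x = A x" by (auto simp: lones_def)
    then show False using xB b by simp
  qed
  moreover have "T = {x}"
  proof -
    have "x \<in> T" using not_lone_T[OF xB(1), of u] uv \<open>lones x = {}\<close> by (auto simp: lones_def)
    moreover have "z = x" if "z \<in> T" for z using that tw twin_not_T unfolding T_iff by blast
    ultimately show ?thesis by blast
  qed
  ultimately have "tri x" using b xB(1) by (simp add: tri_def)
  then show ?thesis using mixed_critical[OF _ _ e] tw \<open>T = {x}\<close> by blast
next
  assume c: "(\<forall>x\<in>B. big x \<or> twin x) \<and> (\<exists>x\<in>B. big x)"
  then have "T \<noteq> {}" using big_T by blast
  then show ?thesis using mixed_critical[OF _ _ e] c by blast
qed

end

section \<open>The central block\<close>

text \<open>The inner vertices x, y of a shortest path p, x, y, q are central and so lie in B. Their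
  eccentricity 2 puts every outer vertex next to B, maximality of B makes its neighbour there
  unique, and \<open>diamond\<close> makes adjacency outside B transitive. The vertices p and q
  witness two vertices of B that are not bare.\<close>

lemma (in blockgraph) central_block_structure:
  assumes diam: "diameter V E = 3" and cb: "central_block V E B"
  shows "\<exists>pr cp. pendant_cliques V B E pr cp \<and>
    (\<exists>p\<in>V - B. \<exists>q\<in>V - B. pr p \<noteq> pr q)"
proof -
  have d3: "dist E u v \<le> enat 3" if "u \<in> V" "v \<in> V" for u v
  proof -
    have "dist E u v \<le> diameter V E" unfolding diameter_def by (rule Sup_upper) (use that in blast)
    then show ?thesis using diam by (simp add: numeral_eq_enat)
  qed
  obtain p q where pq: "p \<in> V" "q \<in> V" "\<not> dist E p q \<le> enat 2"
  proof (rule ccontr)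
    assume "\<not> thesis"
    then have "\<forall>u\<in>V. \<forall>v\<in>V. dist E u v \<le> enat 2" using that by blast
    then have "diameter V E \<le> enat 2" unfolding diameter_def by (intro Sup_least) blast
    then show False using diam by (simp add: numeral_eq_enat)
  qed
  obtain x y where xy: "near E p x" "near E x y" "near E y q"
    using d3[OF pq(1,2)] unfolding dist_le_3 by blast
  have nf: "\<not> (near E p w \<and> near E w q)" for w using pq(3) dist_le_2 by metis
  have e: "{p, x} \<in> E" "{x, y} \<in> E" "{y, q} \<in> E"
    using nf xy unfolding near_def by metis+
  have V: "x \<in> V" "y \<in> V" using e edge_in_V by blast+
  have qp: "\<not> dist E q p \<le> enat 2" using nf near_sym dist_le_2 by metis
  have ex: "dist E x v \<le> enat 2" if "v \<in> V" for v
    by (rule ecc_inner_geodesic[OF d3 pq(3) e that])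
  have ey: "dist E y v \<le> enat 2" if "v \<in> V" for v
    by (rule ecc_inner_geodesic[OF d3 qp _ _ _ that]) (use e in \<open>auto simp: insert_commute\<close>)
  \<comment> \<open>A vertex of eccentricity at most 1 would join p and q in two steps.\<close>
  have ecc_ge: "enat 2 \<le> ecc V E w" if "w \<in> V" for w
  proof (rule ccontr)
    assume "\<not> ?thesis"
    then have "ecc V E w < enat 2" by simp
    then have lt: "dist E w u < enat 2" if "u \<in> V" for u
    proof -
      have "dist E w u \<le> ecc V E w" unfolding ecc_def by (rule Sup_upper) (use that in blast)
      then show ?thesis using \<open>ecc V E w < enat 2\<close> by (rule le_less_trans)
    qed
    have "dist E w u \<le> enat 1" if "u \<in> V" for u
      using lt[OF that] by (cases "dist E w u") auto
    then have "near E w p" "near E w q" using pq dist_le_1 by metis+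
    then show False using nf near_sym by metis
  qed
  have "ecc V E x \<le> enat 2" "ecc V E y \<le> enat 2"
    unfolding ecc_def using ex ey by (auto intro!: Sup_least)
  then have "x \<in> center V E" "y \<in> center V E"
    using V ecc_ge order_trans unfolding center_def by blast+
  then have B: "x \<in> B" "y \<in> B" using cb unfolding central_block_def by blast+
  have blk: "block V E B" using cb unfolding central_block_def by blast
  then have BV: "B \<subseteq> V" and cl: "\<And>a b. a \<in> B \<Longrightarrow> b \<in> B \<Longrightarrow> a \<noteq> b \<Longrightarrow> {a, b} \<in> E"
    and mx: "\<And>T. B \<subset> T \<Longrightarrow> T \<subseteq> V \<Longrightarrow> \<not> clique E T"
    unfolding block_iff clique_def by blast+
  \<comment> \<open>Through two neighbours a and b in B, \<open>diamond\<close> would make v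
    adjacent to all of B, against maximality.\<close>
  have two: "a = b" if v: "v \<in> V - B" and ab: "a \<in> B" "b \<in> B" "{v, a} \<in> E" "{v, b} \<in> E" for v a b
  proof (rule ccontr)
    assume ne: "a \<noteq> b"
    have "{v, c} \<in> E" if c: "c \<in> B" for c
    proof (cases "c = a \<or> c = b")
      case False
      then show ?thesis
        using diamond[of a v c b] ab cl[of a c] cl[of b c] c v ne by (auto simp: insert_commute)
    qed (use ab in auto)
    then have "clique E (insert v B)" using cl unfolding clique_def by (metis insert_commute insert_iff)
    then show False using mx[of "insert v B"] v BV by blast
  qed
  \<comment> \<open>v is within distance 2 of both x and y. With middle vertices w, w' outside B,
    the walk w, v, w', y avoids x and forces the edge \<open>wy\<close>, so w would have two
    neighbours in B.\<close>
  have ex_nbr: "\<exists>b\<in>B. {v, b} \<in> E" if v: "v \<in> V - B" for v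
  proof (rule ccontr)
    assume no: "\<not> ?thesis"
    have "v \<in> V" using v by blast
    obtain w where w: "near E x w" "near E w v" using ex[OF \<open>v \<in> V\<close>] dist_le_2 by metis
    obtain w' where w': "near E y w'" "near E w' v" using ey[OF \<open>v \<in> V\<close>] dist_le_2 by metis
    have nB: "w \<notin> B" "w' \<notin> B" using no w(2) w'(2) v by (auto simp: near_def insert_commute)
    then have wx: "{x, w} \<in> E" and wy: "{y, w'} \<in> E" using w(1) w'(1) B by (auto simp: near_def)
    let ?r = "{(u, v). {u, v} \<in> E \<and> u \<noteq> x \<and> v \<noteq> x}\<^sup>*"
    have "(w, v) \<in> ?r" "(v, w') \<in> ?r" "(w', y) \<in> ?r"
      using near_chain_linked[OF w(2), of x] near_chain_linked[OF near_sym[OF w'(2)], of x]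
        near_chain_linked[OF near_sym[OF w'(1)], of x] nB v B edge_in_V[OF e(2)] by auto
    then have "(w, y) \<in> ?r" by (meson rtrancl_trans)
    then have "{w, y} \<in> E"
      using adjacent_if_linked_avoiding[of w y x] wx e nB B by blast
    moreover have "w \<in> V - B" using nB wx edge_in_V by blast
    ultimately have "x = y" using two[of w x y] B wx by (simp add: insert_commute)
    then show False using e edge_in_V by blast
  qed
  define pr where "pr v = (SOME b. b \<in> B \<and> {v, b} \<in> E)" for v
  have pr: "pr v \<in> B" "{v, pr v} \<in> E" if "v \<in> V - B" for v
    using someI_ex[of "\<lambda>b. b \<in> B \<and> {v, b} \<in> E"] ex_nbr[OF that] unfolding pr_def by blast+
  have pr_eq: "pr v = b" if "v \<in> V - B" "b \<in> B" "{v, b} \<in> E" for v b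
    using two[OF that(1) pr(1)[OF that(1)] that(2) pr(2)[OF that(1)] that(3)] .
  have same: "pr u = pr v" if u: "u \<in> V - B" and v: "v \<in> V - B" and uv: "near E u v" for u v
  proof (rule ccontr)
    assume ne: "pr u \<noteq> pr v"
    then have "{u, v} \<in> E" using uv by (auto simp: near_def)
    then have "{u, pr v} \<in> E"
      using diamond[of v u "pr v" "pr u"] pr[OF u] pr[OF v] cl ne u v by (auto simp: insert_commute)
    then show False using pr_eq[OF u pr(1)[OF v]] ne by blast
  qed
  \<comment> \<open>u and w are both adjacent to v and to the common root, so \<open>diamond\<close>
    gives the edge between them.\<close>
  have trans: "near E u w" if "u \<in> V - B" "v \<in> V - B" "w \<in> V - B" "near E u v" "near E v w" for u v w
  proof (cases "u = v \<or> v = w \<or> u = w")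
    case True
    then show ?thesis using that by auto
  next
    case False
    have "{v, u} \<in> E" "{v, w} \<in> E" using False that(4,5) by (auto simp: near_def insert_commute)
    moreover have "{pr v, u} \<in> E" "{pr v, w} \<in> E"
      using pr(2)[OF that(1)] pr(2)[OF that(3)] same[OF that(1,2,4)] same[OF that(2,3,5)]
      by (simp_all add: insert_commute)
    moreover have "v \<noteq> pr v" using pr(1)[OF that(2)] that(2) by auto
    ultimately show ?thesis using diamond[of v u w "pr v"] False by (simp add: near_def)
  qed
  \<comment> \<open>By transitivity the predicate is the same for all vertices of one attached
    clique, so they share the chosen representative.\<close>
  define cp where "cp v = (SOME w. w \<in> V - B \<and> near E v w)" for v
  have cp: "cp v \<in> V - B" "near E v (cp v)" if "v \<in> V - B" for v
    using someI_ex[of "\<lambda>w. w \<in> V - B \<and> near E v w"] near_refl[of E v] that unfolding cp_def by blast+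
  have cp_eq: "cp u = cp v \<longleftrightarrow> near E u v" if u: "u \<in> V - B" and v: "v \<in> V - B" for u v
  proof
    assume "cp u = cp v"
    then show "near E u v" using trans[OF u _ v] cp[OF u] near_sym[OF cp(2)[OF v]] by metis
  next
    assume uv: "near E u v"
    have "(w \<in> V - B \<and> near E u w) = (w \<in> V - B \<and> near E v w)" for w
      using trans[OF u v, of w] trans[OF v u, of w] uv near_sym[OF uv] by blast
    then show "cp u = cp v" unfolding cp_def by simp
  qed
  have finB: "finite B" using gr BV finite_subset by (auto simp: graph_def)
  have xney: "x \<noteq> y" using e edge_in_V by blast
  have "pendant_cliques V B E pr cp"
  proof
    show "2 \<le> card B" using card_mono[OF finB, of "{x, y}"] B xney by simp
    show "cp (cp v) = cp v" if "v \<in> V - B" for v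
      using cp_eq[OF cp(1)[OF that] that] near_sym[OF cp(2)[OF that]] by blast
    show "pr (cp v) = pr v" if "v \<in> V - B" for v
      using same[OF that cp[OF that]] by simp
    show "{u, v} \<in> E \<longleftrightarrow> u \<noteq> v" if "u \<in> B" "v \<in> B" for u v
      using cl that edge_in_V by blast
    show "{u, v} \<in> E \<longleftrightarrow> pr v = u" if "u \<in> B" "v \<in> V - B" for u v
      using pr_eq[OF that(2,1)] pr[OF that(2)] by (auto simp: insert_commute)
    show "{u, v} \<in> E \<longleftrightarrow> u \<noteq> v \<and> cp u = cp v" if "u \<in> V - B" "v \<in> V - B" for u v
      using cp_eq[OF that] edge_in_V unfolding near_def by blast
  qed (use gr BV pr cp in auto)
  moreover have "p \<notin> B" "q \<notin> B"
    using nf[of y] nf[of x] cl[of p y] cl[of x q] B e by (auto simp: near_def)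
  then have pV: "p \<in> V - B" "q \<in> V - B" using pq by auto
  moreover have "pr p = x" using pr_eq[OF pV(1) B(1)] e by blast
  moreover have "pr q = y" using pr_eq[OF pV(2) B(2)] e by (simp add: insert_commute)
  ultimately show ?thesis using xney by blast
qed

section \<open>Degrees, leaves and side blocks in terms of the attached cliques\<close>

context pendant_cliques
begin

definition cls :: "'a \<Rightarrow> 'a set" where "cls v = {u \<in> V - B. cp u = cp v}"

lemma degree_B: "x \<in> B \<Longrightarrow> degree E x = card B - 1 + card (A x)"
proof -
  assume x: "x \<in> B"
  have "nbrs E x = (B - {x}) \<union> A x"
    using x edge_BB[of x] edge_BA[of x] edge_in_V BV unfolding nbrs_def A_def by blast
  moreover have "(B - {x}) \<inter> A x = {}" by (auto simp: A_iff)
  ultimately show ?thesis using x by (simp add: degree_def card_Un_disjoint)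
qed

lemma degree_outer: "v \<in> V - B \<Longrightarrow> degree E v = 1 \<longleftrightarrow> lone v"
proof -
  assume v: "v \<in> V - B"
  have "u \<in> nbrs E v \<longleftrightarrow> u \<in> insert (pr v) (cls v - {v})" for u
    using edge_AB[OF v, of u] edge_AA[OF v, of u] pr_in[OF v] edge_in_V[of v u]
    by (cases "u \<in> V"; cases "u \<in> B") (use BV in \<open>auto simp: nbrs_def cls_def\<close>)
  then have "nbrs E v = insert (pr v) (cls v - {v})" by blast
  moreover have "pr v \<notin> cls v - {v}" using pr_in[OF v] by (auto simp: cls_def)
  moreover have "finite (cls v - {v})" by (simp add: cls_def)
  ultimately have "degree E v = 1 \<longleftrightarrow> cls v - {v} = {}" by (simp add: degree_def)
  also have "\<dots> \<longleftrightarrow> lone v" using v by (auto simp: cls_def lone_def)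
  finally show ?thesis .
qed

text \<open>The degree condition keeps vertices of B from being leaves, so all leaf neighbours of x
  lie outside B.\<close>

lemma leaf_nbrs_eq:
  assumes "x \<in> B" "\<And>b. b \<in> B \<Longrightarrow> 2 \<le> degree E b"
  shows "leaf_nbrs E x = lones x"
proof -
  have "u \<in> leaf_nbrs E x \<longleftrightarrow> u \<in> lones x" for u
  proof (cases "u \<in> V - B")
    case True
    then show ?thesis using degree_outer[OF True] edge_BA[OF assms(1) True]
      by (simp add: leaf_nbrs_def lones_def nbrs_def A_iff)
  next
    case False
    then have "u \<notin> lones x" by (auto simp: lones_def A_iff)
    moreover have "u \<notin> leaf_nbrs E x"
      using False edge_in_V[of x u] assms(2)[of u] by (auto simp: leaf_nbrs_def nbrs_def)
    ultimately show ?thesis by blast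
  qed
  then show ?thesis by blast
qed

lemma cls_A: "v \<in> A x \<Longrightarrow> cls v \<subseteq> A x"
  using same_class_A by (auto simp: cls_def)

lemma self_cls: "v \<in> A x \<Longrightarrow> v \<in> cls v"
  by (simp add: cls_def A_iff)

lemma card_insert_cls:
  assumes "x \<in> B" "v \<in> A x" shows "card (insert x (cls v)) = Suc (card (cls v))"
proof -
  have "x \<notin> cls v" "finite (cls v)" using assms(1) by (auto simp: cls_def)
  then show ?thesis by simp
qed

lemma clique_containing_outer:
  assumes "clique E S" "S \<subseteq> V" "v \<in> S" "v \<in> V - B"
  shows "S \<subseteq> insert (pr v) (cls v)"
proof
  fix u assume u: "u \<in> S"
  show "u \<in> insert (pr v) (cls v)"
  proof (cases "u = v")
    case False
    then have "{v, u} \<in> E" using assms u by (auto simp: clique_def)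
    then show ?thesis
      using edge_AB[of v u] edge_AA[of v u] assms u by (cases "u \<in> B") (auto simp: cls_def)
  qed (use assms in \<open>simp add: cls_def\<close>)
qed

lemma clique_insert_cls:
  assumes "v \<in> V - B" shows "clique E (insert (pr v) (cls v))"
proof -
  have "{a, b} \<in> E" if "a \<in> insert (pr v) (cls v)" "b \<in> insert (pr v) (cls v)" "a \<noteq> b" for a b
  proof -
    have c: "w \<in> V - B \<and> pr w = pr v \<and> cp w = cp v" if "w \<in> cls v" for w
      using that same_class_pr[of w v] assms by (auto simp: cls_def)
    show ?thesis
      using that c[of a] c[of b] edge_BA[OF pr_in[OF assms], of b] edge_AB[OF _ pr_in[OF assms], of a]
        edge_AA[of a b] by auto
  qed
  then show ?thesis by (simp add: clique_def)
qed

text \<open>A clique through an outer vertex v is confined to its root and its attached clique, so a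
  maximal one is that whole set; a block without outer vertices is contained in B and hence equals
  B.\<close>

lemma side_block_iff:
  assumes "blockgraph V E" "block V E B" "x \<in> B"
  shows "side_block V E B S \<and> x \<in> S \<longleftrightarrow> (\<exists>v\<in>A x. S = insert x (cls v))"
proof
  assume S: "side_block V E B S \<and> x \<in> S"
  then have Sb: "S \<subseteq> V" "clique E S" "\<And>T. S \<subset> T \<Longrightarrow> T \<subseteq> V \<Longrightarrow> \<not> clique E T" "S \<noteq> B"
    unfolding side_block_def blockgraph.block_iff[OF assms(1)] by blast+
  have cB: "clique E B" using assms(2) unfolding blockgraph.block_iff[OF assms(1)] by blast
  have "\<not> S \<subseteq> B" using Sb(3)[of B] Sb(4) cB BV by blast
  then obtain v where v: "v \<in> S" "v \<in> V - B" using Sb(1) by blast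
  have "S \<subseteq> insert (pr v) (cls v)" by (rule clique_containing_outer[OF Sb(2,1) v])
  moreover have "insert (pr v) (cls v) \<subseteq> V" using pr_in[OF v(2)] BV by (auto simp: cls_def)
  ultimately have eq: "S = insert (pr v) (cls v)"
    using Sb(3) clique_insert_cls[OF v(2)] by blast
  moreover have "x \<notin> cls v" using assms(3) by (auto simp: cls_def)
  ultimately have "pr v = x" using S by blast
  then show "\<exists>v\<in>A x. S = insert x (cls v)" using eq v(2) by (auto simp: A_iff)
next
  assume "\<exists>v\<in>A x. S = insert x (cls v)"
  then obtain v where v: "v \<in> V - B" "pr v = x" and S: "S = insert (pr v) (cls v)"
    by (auto simp: A_iff)
  have vS: "v \<in> S" using v S by (simp add: cls_def)
  have "S \<subseteq> V" using S pr_in[OF v(1)] BV by (auto simp: cls_def)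
  moreover have "\<not> clique E T" if "S \<subset> T" "T \<subseteq> V" for T
  proof
    assume "clique E T"
    then have "T \<subseteq> S" using clique_containing_outer[OF _ that(2) _ v(1)] vS that(1) S by blast
    then show False using that(1) by blast
  qed
  ultimately have "block V E S"
    unfolding blockgraph.block_iff[OF assms(1)] using clique_insert_cls[OF v(1)] vS S by blast
  moreover have "S \<noteq> B" using vS v(1) by blast
  ultimately show "side_block V E B S \<and> x \<in> S" using S v(2) by (simp add: side_block_def)
qed

text \<open>The order of a side block counts x as well, so orders at least 4 and exactly 3 are
  attached cliques with at least three and exactly two vertices. Conversely, if no clique has three
  vertices, all have exactly two, and three outer neighbours require two cliques.\<close>

lemma big_iff:
  assumes "blockgraph V E" "block V E B" "x \<in> B" and leaf: "leaf_nbrs E x = lones x"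
  shows "((\<exists>S. side_block V E B S \<and> x \<in> S \<and> card S \<ge> 4) \<and> leaf_nbrs E x = {})
    \<or> (card {S. side_block V E B S \<and> x \<in> S \<and> card S = 3} \<ge> 2 \<and> leaf_nbrs E x = {}) \<longleftrightarrow> big x"
    (is "(?c1 \<and> _) \<or> (card ?F \<ge> 2 \<and> _) \<longleftrightarrow> _")
proof -
  note side = side_block_iff[OF assms(1-3)]
  have cA: "card X \<le> card (A x)" if "X \<subseteq> A x" for X using that by (rule card_mono[OF finA])
  have "?c1 \<or> card ?F \<ge> 2 \<longleftrightarrow> 3 \<le> card (A x)" if nl: "lones x = {}"
  proof
    assume "?c1 \<or> card ?F \<ge> 2"
    then show "3 \<le> card (A x)"
    proof
      assume ?c1
      then obtain S where "side_block V E B S \<and> x \<in> S" "4 \<le> card S" by blast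
      then obtain v where v: "v \<in> A x" "4 \<le> card (insert x (cls v))" using side[of S] by blast
      then have "3 \<le> card (cls v)" using card_insert_cls[OF assms(3) v(1)] by simp
      then show ?thesis using cA[OF cls_A[OF v(1)]] by linarith
    next
      assume F2: "card ?F \<ge> 2"
      \<comment> \<open>An infinite set has \<open>card\<close> 0, so the lower bound itself gives
        finiteness.\<close>
      then have "finite ?F" by (metis card.infinite not_numeral_le_zero)
      then obtain S S' where SS: "S \<in> ?F" "S' \<in> ?F" "S \<noteq> S'"
        using F2 card_le_Suc0_iff_eq[of ?F] by force
      then obtain v v' where v: "v \<in> A x" "S = insert x (cls v)" "v' \<in> A x" "S' = insert x (cls v')"
        using side[of S] side[of S'] by blast
      have c: "card (cls v) = 2" "card (cls v') = 2"
        using SS v card_insert_cls[OF assms(3)] by auto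
      have "cls v \<noteq> cls v'" using SS v by blast
      moreover have fin: "finite (cls v)" "finite (cls v')" by (simp_all add: cls_def)
      ultimately have "\<not> cls v' \<subseteq> cls v" using c card_subset_eq by metis
      then have "cls v \<subset> cls v \<union> cls v'" by blast
      then have "2 < card (cls v \<union> cls v')"
        using psubset_card_mono[of "cls v \<union> cls v'" "cls v"] fin c(1) by simp
      then show ?thesis using cA[of "cls v \<union> cls v'"] cls_A[OF v(1)] cls_A[OF v(3)] by simp
    qed
  next
    assume A3: "3 \<le> card (A x)"
    show "?c1 \<or> card ?F \<ge> 2"
    proof (cases "\<exists>v\<in>A x. 3 \<le> card (cls v)")
      case True
      then obtain v where v: "v \<in> A x" "3 \<le> card (cls v)" by blast
      then have "4 \<le> card (insert x (cls v))" using card_insert_cls[OF assms(3)] by simp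
      then have ?c1 using side[of "insert x (cls v)"] v(1) by blast
      then show ?thesis by blast
    next
      case False
      have c2: "card (cls v) = 2" if v: "v \<in> A x" for v
      proof -
        have "\<not> lone v" using nl v by (auto simp: lones_def)
        then obtain u where "u \<in> A x" "u \<noteq> v" "cp u = cp v" using not_lone[OF v] by blast
        then have "{u, v} \<subseteq> cls v" "card {u, v} = 2" using v by (auto simp: cls_def A_iff)
        then have "2 \<le> card (cls v)" using card_mono[of "cls v" "{u, v}"] by (simp add: cls_def)
        then show ?thesis using False v by force
      qed
      have "A x \<noteq> {}" using A3 by auto
      then obtain v where v: "v \<in> A x" by blast
      have "\<not> A x \<subseteq> cls v"
      proof
        assume "A x \<subseteq> cls v"
        then have "A x = cls v" using cls_A[OF v] by blast
        then show False using c2[OF v] A3 by simp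
      qed
      then obtain w where w: "w \<in> A x" "w \<notin> cls v" by blast
      let ?S = "insert x (cls v)" and ?S' = "insert x (cls w)"
      have "w \<noteq> x" using w(1) assms(3) by (auto simp: A_iff)
      then have ne: "?S \<noteq> ?S'" using w self_cls[OF w(1)] by blast
      have "?S \<in> ?F" "?S' \<in> ?F"
        using side[of ?S] side[of ?S'] v w(1) c2 card_insert_cls[OF assms(3)] by auto
      moreover have "finite ?F"
        by (rule finite_subset[of _ "(\<lambda>v. insert x (cls v)) ` A x"]) (use side in auto)
      ultimately have "card {?S, ?S'} \<le> card ?F" by (intro card_mono) auto
      then show ?thesis using ne by simp
    qed
  qed
  then show ?thesis unfolding leaf big_def by blast
qed

end

theorem theorem5p2:
  fixes V :: "'a set" and E :: "'a set set" and B :: "'a set"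
  assumes "graph V E" and "block_graph V E" and "diameter V E = 3"
    and "central_block V E B"
  shows "packing_critical V E \<longleftrightarrow>
    ((\<forall>x\<in>B. degree E x = card B)
     \<or> ((\<forall>x\<in>B. degree E x = card B + 1) \<and>
        card {x \<in> B. card (leaf_nbrs E x) \<ge> 2} = card B - 1)
     \<or> ((\<forall>x\<in>B.
          ((\<exists>S. side_block V E B S \<and> x \<in> S \<and> card S \<ge> 4) \<and> leaf_nbrs E x = {})
          \<or> (card {S. side_block V E B S \<and> x \<in> S \<and> card S = 3} \<ge> 2 \<and> leaf_nbrs E x = {})
          \<or> (degree E x = card B + 1 \<and> card (leaf_nbrs E x) \<ge> 2))
        \<and> (\<exists>x\<in>B.
          ((\<exists>S. side_block V E B S \<and> x \<in> S \<and> card S \<ge> 4) \<and> leaf_nbrs E x = {})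
          \<or> (card {S. side_block V E B S \<and> x \<in> S \<and> card S = 3} \<ge> 2 \<and> leaf_nbrs E x = {}))))"
proof -
  have bg: "blockgraph V E" using assms(1,2) by unfold_locales
  have blk: "block V E B" using assms(4) unfolding central_block_def by blast
  obtain pr cp p q where pc: "pendant_cliques V B E pr cp"
    and pq: "p \<in> V - B" "q \<in> V - B" "pr p \<noteq> pr q"
    using blockgraph.central_block_structure[OF bg assms(3,4)] by blast
  interpret pendant_cliques V B E pr cp by (rule pc)
  have yz: "pr p \<in> B" "pr q \<in> B" "pr p \<noteq> pr q" "A (pr p) \<noteq> {}" "A (pr q) \<noteq> {}"
    using pq pr_in by (auto simp: A_iff)
  have deg: "degree E x = card B \<longleftrightarrow> card (A x) = 1"
    "degree E x = card B + 1 \<longleftrightarrow> card (A x) = 2" if "x \<in> B" for x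
    using degree_B[OF that] card_B by linarith+
  \<comment> \<open>The roots of p and q have an outer neighbour and a neighbour in B; any other
    vertex of B sees both of these roots.\<close>
  have deg2: "2 \<le> degree E b" if b: "b \<in> B" for b
  proof (cases "b = pr p \<or> b = pr q")
    case True
    then have "A b \<noteq> {}" using yz by blast
    then have "0 < card (A b)" by (simp add: card_gt_0_iff)
    then show ?thesis using degree_B[OF b] card_B by linarith
  next
    case False
    then have "card {b, pr p, pr q} = 3" using yz by simp
    then have "3 \<le> card B" using card_mono[OF finB, of "{b, pr p, pr q}"] b yz by simp
    then show ?thesis using degree_B[OF b] by linarith
  qed
  have leaf: "leaf_nbrs E x = lones x" if "x \<in> B" for x by (rule leaf_nbrs_eq[OF that deg2])
  have big: "((\<exists>S. side_block V E B S \<and> x \<in> S \<and> card S \<ge> 4) \<and> leaf_nbrs E x = {})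
    \<or> (card {S. side_block V E B S \<and> x \<in> S \<and> card S = 3} \<ge> 2 \<and> leaf_nbrs E x = {}) \<longleftrightarrow> big x"
    if "x \<in> B" for x by (rule big_iff[OF bg blk that leaf[OF that]])
  have twin: "degree E x = card B + 1 \<and> card (leaf_nbrs E x) \<ge> 2 \<longleftrightarrow> twin x" if "x \<in> B" for x
    unfolding twin_def using deg(2)[OF that] leaf[OF that] by simp
  have a: "(\<forall>x\<in>B. degree E x = card B) \<longleftrightarrow> (\<forall>x\<in>B. card (A x) = 1)" using deg(1) by blast
  have b1: "(\<forall>x\<in>B. degree E x = card B + 1) \<longleftrightarrow> (\<forall>x\<in>B. card (A x) = 2)" using deg(2) by blast
  have b2: "{x \<in> B. card (leaf_nbrs E x) \<ge> 2} = {x \<in> B. card (lones x) \<ge> 2}" using leaf by auto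
  have c1: "(\<forall>x\<in>B.
          ((\<exists>S. side_block V E B S \<and> x \<in> S \<and> card S \<ge> 4) \<and> leaf_nbrs E x = {})
          \<or> (card {S. side_block V E B S \<and> x \<in> S \<and> card S = 3} \<ge> 2 \<and> leaf_nbrs E x = {})
          \<or> (degree E x = card B + 1 \<and> card (leaf_nbrs E x) \<ge> 2)) \<longleftrightarrow> (\<forall>x\<in>B. big x \<or> twin x)"
    \<comment> \<open>Regrouped so that (c1) and (c2) form one disjunction, which matches
      \<open>big\<close>.\<close>
    unfolding disj_assoc[symmetric] by (intro ball_cong refl) (simp only: big twin)
  have c2: "(\<exists>x\<in>B.
          ((\<exists>S. side_block V E B S \<and> x \<in> S \<and> card S \<ge> 4) \<and> leaf_nbrs E x = {})
          \<or> (card {S. side_block V E B S \<and> x \<in> S \<and> card S = 3} \<ge> 2 \<and> leaf_nbrs E x = {}))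
      \<longleftrightarrow> (\<exists>x\<in>B. big x)"
    by (intro bex_cong refl) (simp only: big)
  have cov: "\<exists>e\<in>E. v \<in> e" if v: "v \<in> V" for v
  proof (cases "v \<in> B")
    case True
    obtain b where "b \<in> B" "b \<noteq> v" using two_in_B by metis
    then show ?thesis using edge_BB[OF True] by blast
  next
    case False
    then show ?thesis using edge_AB[of v "pr v"] pr_in[of v] v by blast
  qed
  have crit_iff: "packing_critical V E \<longleftrightarrow>
      (\<forall>e\<in>E. packing_chromatic V (E - {e}) < packing_chromatic V E)"
    by (rule critical_iff_edges[OF assms(1)]) (rule cov)
  show ?thesis
    unfolding a b1 b2 c1 c2
  proof
    assume "packing_critical V E"
    then show "(\<forall>x\<in>B. card (A x) = 1)
      \<or> (\<forall>x\<in>B. card (A x) = 2) \<and> card {x \<in> B. 2 \<le> card (lones x)} = card B - 1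
      \<or> (\<forall>x\<in>B. big x \<or> twin x) \<and> (\<exists>x\<in>B. big x)"
      by (rule critical_cases[OF _ yz])
  next
    assume "(\<forall>x\<in>B. card (A x) = 1)
      \<or> (\<forall>x\<in>B. card (A x) = 2) \<and> card {x \<in> B. 2 \<le> card (lones x)} = card B - 1
      \<or> (\<forall>x\<in>B. big x \<or> twin x) \<and> (\<exists>x\<in>B. big x)"
    then show "packing_critical V E"
      unfolding crit_iff using edges_critical_if by blast
  qed
qed

end
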